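(* Let $(X,(\|\cdot\|_q)_{q\ge 1})$ be a Fréchet sequence algebra under the Cauchy product in which $(e_n)_{n\ge 0}$ is a basis with Property B, and let $B_w$ be a mixing weighted backward shift on $X$. Then there exists a point $x\in HC(B_w)$ such that the algebra generated by $x$, except zero, is contained in $HC(B_w)$.
   Context: $\omega$ is the space of all complex sequences $x=(x_n)_{n\ge 0}$ with the topology of coordinatewise convergence; $e_n\in\omega$ is the sequence with $1$ at index $n$ and $0$ elsewhere. The Cauchy product of $x,y\in\omega$ is $x\ast y=(z_n)_n$ with $z_n=\sum_{k=0}^n x_ky_{n-k}$. A Fréchet algebra is a complex algebra $X$ that is a (locally convex) Fréchet space whose topology is induced by an increasing sequence $(\|\cdot\|_q)_{q\ge1}$ of seminorms that are submultiplicative for the product, i.e. $\|x\ast y\|_q\le\|x\|_q\|y\|_q$ for all $x,y\in X$, $q\ge1$. A Fréchet sequence algebra under the Cauchy product is a subalgebra $X$ of $(\omega,\ast)$ that carries a Fréchet algebra structure such that the embedding $X\hookrightarrow\omega$ is continuous. "Basis" means Schauder basis. Property B of $(e_n)_n$: $X$ contains all $e_n$ and (i) there is some $q\ge1$ such that $\|e_n\|_q>0$ for all $n\ge0$; (ii) for any $r\ge1$ there are $q\ge1$ and $C_1>0$ such that $\|e_n\|_r\cdot\|e_k\|_r\le C_1\|e_{n+k}\|_q$ for all $n,k\ge0$; (iii) for any $m\ge2$, $M\ge1$, $r\ge1$ there is some $\rho\ge1$ such that for any $t\ge1$ there are $\tau\ge1$ and $C_2>0$ such that, for any $0\le k\le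 M$ and $n\ge M$, $\|e_{mn}\|_t\cdot\|e_{n-k}\|_r\le C_2\|e_{mn}\|_\tau^{1/m}\cdot\|e_{mn-k}\|_\rho$. A weight is a sequence $w=(w_n)_{n\ge0}$ of non-zero complex numbers, with the convention $w_0=1$. The weighted backward shift is $B_w(x_0,x_1,x_2,\dots)=(w_1x_1,w_2x_2,w_3x_3,\dots)$; saying that it is a weighted backward shift on $X$ means that it maps $X$ into $X$ (it is then a continuous linear operator on $X$). An operator $T$ on $X$ is mixing if for any non-empty open $U,V\subset X$ the set $\{n\ge0:T^n(U)\cap V\ne\varnothing\}$ is co-finite. $HC(T)=\{x\in X:\{x,Tx,T^2x,\dots\}\text{ is dense in }X\}$. The algebra generated by $x$ is the smallest (not necessarily unital) subalgebra containing $x$, i.e. the set of all finite sums $\sum_{\mu=1}^N c_\mu x^\mu$ with $N\ge1$ and $c_\mu\in\mathbb{C}$, where $x^\mu=x\ast\cdots\ast x$ ($\mu$ factors); there is no constant term. *)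

theory Defs
  imports "HOL-Analysis.Analysis" "HOL-Computational_Algebra.Formal_Power_Series"
begin

text \<open>
  Complex sequences \<open>(x\<^sub>n)\<close> are represented by the type \<^typ>\<open>complex fps\<close>: \<open>fps_nth x n\<close> is the \<open>n\<close>-th
  coordinate, multiplication (and hence \<open>x ^ k\<close>) is the Cauchy product, and \<open>fps_const c * x\<close> is
  multiplication by the scalar \<open>c\<close>. The type class topology of \<^typ>\<open>complex fps\<close> is the
  \<open>X\<close>-adic one, which is \<^emph>\<open>not\<close> that of coordinatewise convergence; it is never used here. All
  topologies are explicit, and coordinatewise convergence is expressed by the product topology
  on \<^typ>\<open>nat \<Rightarrow> complex\<close> via \<^const>\<open>fps_nth\<close>.
\<close>

definition unit_seq :: "nat \<Rightarrow> complex fps" where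
  "unit_seq n = Abs_fps (\<lambda>i. if i = n then 1 else 0)"

text \<open>Subalgebras are not required to contain the unit \<open>1 = unit_seq 0\<close>.\<close>

definition subalgebra :: "complex fps set \<Rightarrow> bool" where
  "subalgebra A \<longleftrightarrow> 0 \<in> A \<and> (\<forall>x\<in>A. \<forall>y\<in>A. x + y \<in> A) \<and>
     (\<forall>c. \<forall>x\<in>A. fps_const c * x \<in> A) \<and> (\<forall>x\<in>A. \<forall>y\<in>A. x * y \<in> A)"

definition generated_algebra :: "complex fps \<Rightarrow> complex fps set" where
  "generated_algebra x = subalgebra hull {x}"

text \<open>Seminorms are indexed by \<open>q \<ge> 1\<close>; the value at index \<open>0\<close> is irrelevant throughout.\<close>

definition seminorm_topology ::
    "complex fps set \<Rightarrow> (nat \<Rightarrow> complex fps \<Rightarrow> real) \<Rightarrow> complex fps topology" where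
  "seminorm_topology X p = topology_generated_by
     {{y \<in> X. p q (y - x) < \<epsilon>} | x q \<epsilon>. x \<in> X \<and> q \<ge> 1 \<and> \<epsilon> > 0}"

locale frechet_sequence_algebra =
  fixes X :: "complex fps set" and p :: "nat \<Rightarrow> complex fps \<Rightarrow> real"
  assumes subalgebra: "subalgebra X"
    and seminorm_nonneg: "\<And>q x. q \<ge> 1 \<Longrightarrow> x \<in> X \<Longrightarrow> 0 \<le> p q x"
    and seminorm_triangle:
      "\<And>q x y. q \<ge> 1 \<Longrightarrow> x \<in> X \<Longrightarrow> y \<in> X \<Longrightarrow> p q (x + y) \<le> p q x + p q y"
    and seminorm_scale:
      "\<And>q c x. q \<ge> 1 \<Longrightarrow> x \<in> X \<Longrightarrow> p q (fps_const c * x) = norm c * p q x"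
    and seminorm_mult:
      "\<And>q x y. q \<ge> 1 \<Longrightarrow> x \<in> X \<Longrightarrow> y \<in> X \<Longrightarrow> p q (x * y) \<le> p q x * p q y"
    and seminorm_mono:
      "\<And>q r x. 1 \<le> q \<Longrightarrow> q \<le> r \<Longrightarrow> x \<in> X \<Longrightarrow> p q x \<le> p r x"
    and separating: "\<And>x. x \<in> X \<Longrightarrow> (\<And>q. q \<ge> 1 \<Longrightarrow> p q x = 0) \<Longrightarrow> x = 0"
    and complete: "\<And>s :: nat \<Rightarrow> complex fps. range s \<subseteq> X \<Longrightarrow>
        (\<And>q \<epsilon>. q \<ge> 1 \<Longrightarrow> \<epsilon> > 0 \<Longrightarrow> \<exists>N. \<forall>m\<ge>N. \<forall>n\<ge>N. p q (s m - s n) < \<epsilon>) \<Longrightarrow>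
        \<exists>l\<in>X. limitin (seminorm_topology X p) s l sequentially"
    and continuous_embedding:
      "continuous_map (seminorm_topology X p) (product_topology (\<lambda>_. euclidean) UNIV) fps_nth"

text \<open>
  Continuity of the coordinate functionals is not demanded separately: it is automatic in
  Frechet spaces.
\<close>

definition schauder_basis ::
    "complex fps set \<Rightarrow> (nat \<Rightarrow> complex fps \<Rightarrow> real) \<Rightarrow> (nat \<Rightarrow> complex fps) \<Rightarrow> bool" where
  "schauder_basis X p b \<longleftrightarrow> range b \<subseteq> X \<and>
     (\<forall>x\<in>X. \<exists>!a :: nat \<Rightarrow> complex.
        limitin (seminorm_topology X p) (\<lambda>N. \<Sum>n<N. fps_const (a n) * b n) x sequentially)"

definition property_B ::
    "complex fps set \<Rightarrow> (nat \<Rightarrow> complex fps \<Rightarrow> real) \<Rightarrow> bool" where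
  "property_B X p \<longleftrightarrow>
     (\<forall>n. unit_seq n \<in> X) \<and>
     (\<exists>q\<ge>1. \<forall>n. p q (unit_seq n) > 0) \<and>
     (\<forall>r\<ge>1. \<exists>q\<ge>1. \<exists>C>0. \<forall>n k.
        p r (unit_seq n) * p r (unit_seq k) \<le> C * p q (unit_seq (n + k))) \<and>
     (\<forall>m\<ge>2. \<forall>M\<ge>1. \<forall>r\<ge>1. \<exists>\<rho>\<ge>1. \<forall>t\<ge>1. \<exists>\<tau>\<ge>1. \<exists>C>0. \<forall>k\<le>M. \<forall>n\<ge>M.
        p t (unit_seq (m * n)) * p r (unit_seq (n - k))
          \<le> C * p \<tau> (unit_seq (m * n)) powr (1 / real m) * p \<rho> (unit_seq (m * n - k)))"

definition is_weight :: "(nat \<Rightarrow> complex) \<Rightarrow> bool" where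
  "is_weight w \<longleftrightarrow> w 0 = 1 \<and> (\<forall>n. w n \<noteq> 0)"

definition weighted_backward_shift :: "(nat \<Rightarrow> complex) \<Rightarrow> complex fps \<Rightarrow> complex fps" where
  "weighted_backward_shift w x = Abs_fps (\<lambda>n. w (Suc n) * fps_nth x (Suc n))"

definition mixing :: "'a topology \<Rightarrow> ('a \<Rightarrow> 'a) \<Rightarrow> bool" where
  "mixing \<T> T \<longleftrightarrow> (\<forall>U V. openin \<T> U \<and> U \<noteq> {} \<and> openin \<T> V \<and> V \<noteq> {} \<longrightarrow>
     finite (- {n. (T ^^ n) ` U \<inter> V \<noteq> {}}))"

definition hypercyclic_vectors :: "'a topology \<Rightarrow> ('a \<Rightarrow> 'a) \<Rightarrow> 'a set" where
  "hypercyclic_vectors \<T> T =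
     {x \<in> topspace \<T>. \<T> closure_of (range (\<lambda>n. (T ^^ n) x)) = topspace \<T>}"

lemma (in frechet_sequence_algebra) topspace_seminorm_topology:
  "topspace (seminorm_topology X p) = X"
proof
  show "topspace (seminorm_topology X p) \<subseteq> X"
    unfolding seminorm_topology_def topology_generated_by_topspace by blast
next
  have "p 1 0 = 0"
    using seminorm_scale[of 1 0 0] subalgebra by (simp add: subalgebra_def)
  then have "x \<in> {y \<in> X. p 1 (y - x) < 1}" if "x \<in> X" for x
    using that by simp
  moreover have "{y \<in> X. p 1 (y - x) < 1}
      \<in> {{y \<in> X. p q (y - x) < \<epsilon>} | x q \<epsilon>. x \<in> X \<and> q \<ge> 1 \<and> \<epsilon> > 0}" if "x \<in> X" for x
    using that zero_less_one[where 'a = real] by blast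
  ultimately show "X \<subseteq> topspace (seminorm_topology X p)"
    unfolding seminorm_topology_def topology_generated_by_topspace by (meson UnionI subsetI)
qed

lemma generated_algebra_eq:
  "generated_algebra x = {\<Sum>\<mu>=1..N. fps_const (c \<mu>) * x ^ \<mu> | N c. N \<ge> 1}"
proof -
  define f where "f N c = (\<Sum>\<mu>=1..N. fps_const (c \<mu>) * x ^ \<mu>)" for N :: nat and c
  define S where "S = {f N c | N c. N \<ge> 1}"
  have memI: "f N c \<in> S" if "N \<ge> 1" for N c
    unfolding S_def using that by blast
  have memE: "\<exists>N c. N \<ge> 1 \<and> a = f N c" if "a \<in> S" for a
    using that unfolding S_def by blast
  have pad: "f N c = f N' (\<lambda>\<mu>. if \<mu> \<le> N then c \<mu> else 0)" if "N \<le> N'" for N N' c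
    unfolding f_def by (rule sum.mono_neutral_cong_left) (use that in auto)
  have zero: "0 \<in> S"
    using memI[of 1 "\<lambda>_. 0"] by (simp add: f_def)
  have f_add: "f N c + f N d = f N (\<lambda>\<mu>. c \<mu> + d \<mu>)" for N c d
    unfolding f_def sum.distrib[symmetric] distrib_right[symmetric] fps_const_add ..
  have add: "a + b \<in> S" if "a \<in> S" "b \<in> S" for a b
  proof -
    obtain N c where a: "N \<ge> 1" "a = f N c" using memE[OF \<open>a \<in> S\<close>] by blast
    obtain N' c' where b: "N' \<ge> 1" "b = f N' c'" using memE[OF \<open>b \<in> S\<close>] by blast
    show ?thesis
      unfolding a(2) b(2) pad[OF max.cobounded1, of N c N'] pad[OF max.cobounded2, of N' c' N] f_add
      by (rule memI) (use a(1) in simp)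
  qed
  have scale: "fps_const d * a \<in> S" if "a \<in> S" for a d
  proof -
    obtain N c where a: "N \<ge> 1" "a = f N c" using memE[OF \<open>a \<in> S\<close>] by blast
    have "fps_const d * a = f N (\<lambda>\<mu>. d * c \<mu>)"
      unfolding a(2) f_def sum_distrib_left mult.assoc[symmetric] fps_const_mult ..
    then show ?thesis using memI[OF a(1)] by simp
  qed
  have pow: "x ^ k \<in> S" if "k \<ge> 1" for k
  proof -
    have "x ^ k = (\<Sum>\<mu>\<in>{k}. fps_const 1 * x ^ \<mu>)" by simp
    also have "\<dots> = f k (\<lambda>\<mu>. if \<mu> = k then 1 else 0)"
      unfolding f_def by (rule sum.mono_neutral_cong_left) (use that in auto)
    finally show ?thesis using memI[OF that] by simp
  qed
  have sum_mem: "sum g I \<in> A" if "finite I" "subalgebra A" "\<And>i. i \<in> I \<Longrightarrow> g i \<in> A"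
    for g :: "nat \<Rightarrow> complex fps" and I A
    using that(1,3) by induction (use that(2) in \<open>auto simp: subalgebra_def\<close>)
  have sum_mem_S: "sum g I \<in> S" if "finite I" "\<And>i. i \<in> I \<Longrightarrow> g i \<in> S"
    for g :: "nat \<Rightarrow> complex fps" and I
    using that by induction (use zero add in auto)
  have mult: "a * b \<in> S" if "a \<in> S" "b \<in> S" for a b
  proof -
    obtain N c where a: "N \<ge> 1" "a = f N c" using memE[OF \<open>a \<in> S\<close>] by blast
    obtain N' c' where b: "N' \<ge> 1" "b = f N' c'" using memE[OF \<open>b \<in> S\<close>] by blast
    have "a * b = (\<Sum>i=1..N. \<Sum>j=1..N'. fps_const (c i) * (fps_const (c' j) * x ^ (i + j)))"
      unfolding a(2) b(2) f_def sum_product by (simp only: power_add mult_ac)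
    also have "\<dots> \<in> S"
      by (intro sum_mem_S scale pow) auto
    finally show ?thesis .
  qed
  have "subalgebra S"
    unfolding subalgebra_def using zero add scale mult by blast
  moreover have "x \<in> S"
    using pow[of 1] by simp
  ultimately have "generated_algebra x \<subseteq> S"
    unfolding generated_algebra_def by (intro hull_minimal) auto
  moreover have "f N c \<in> A" if A: "subalgebra A" "x \<in> A" for A N c
  proof -
    have "x ^ Suc k \<in> A" for k
      by (induction k) (use A in \<open>auto simp: subalgebra_def\<close>)
    then have "x ^ \<mu> \<in> A" if "\<mu> \<ge> 1" for \<mu>
      using that by (metis Suc_pred' Suc_le_eq One_nat_def)
    then show ?thesis
      unfolding f_def using A(1) by (intro sum_mem) (auto simp: subalgebra_def)
  qed
  then have "S \<subseteq> generated_algebra x"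
    unfolding generated_algebra_def hull_def S_def by blast
  ultimately show ?thesis
    unfolding S_def f_def by (rule subset_antisym)
qed

end

theory Submission imports Defs begin

text \<open>
  Write \<open>T\<close> for the shift and \<open>v\<^sub>n = 1 / (w\<^sub>1 \<cdots> w\<^sub>n)\<close>, so that \<open>T (v\<^sub>n e\<^sub>n) = v\<^sub>n\<^sub>-\<^sub>1 e\<^sub>n\<^sub>-\<^sub>1\<close>; mixing forces
  \<open>v\<^sub>n e\<^sub>n \<rightarrow> 0\<close>. By Baire it suffices, given \<open>m\<close>, a finite sequence \<open>f\<close> and a finite target
  \<open>y\<close>, to find \<open>u\<close> near \<open>f\<close> and \<open>N\<close> with \<open>T\<^sup>N (u\<^sup>m)\<close> near \<open>y\<close> and \<open>T\<^sup>N (u\<^sup>j) = 0\<close> for \<open>j < m\<close>: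
  then \<open>T\<^sup>N\<close> only sees the leading term of a polynomial in \<open>u\<close>. Take
  \<open>u = f + d e\<^sub>n + \<Sum>\<^sub>j\<^sub><\<^sub>L b\<^sub>j e\<^sub>n\<^sub>-\<^sub>M\<^sub>+\<^sub>j\<close> with \<open>M = 2 L + 1\<close>, \<open>N = m n - M\<close> and \<open>n\<close> large. In the
  degrees \<open>\<ge> N\<close> the power \<open>u\<^sup>m\<close> is \<open>d\<^sup>m e\<^sub>m\<^sub>n + m d\<^sup>m\<^sup>-\<^sup>1 \<Sum>\<^sub>j\<^sub><\<^sub>L b\<^sub>j e\<^sub>N\<^sub>+\<^sub>j\<close>, so the \<open>b\<^sub>j\<close> can be solved
  for exactly, while \<open>d\<^sup>m = \<eta> v\<^sub>m\<^sub>n / v\<^sub>M\<close> makes the first summand contribute only \<open>\<eta> e\<^sub>M\<close>.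
\<close>

section \<open>Null sequences of reals and coordinates of unit sequences\<close>

lemma tendsto_zero_squeeze:
  fixes f g :: "nat \<Rightarrow> real"
  assumes "g \<longlonglongrightarrow> 0" "\<And>n. n \<ge> N \<Longrightarrow> f n \<le> g n" "\<And>n. 0 \<le> f n"
  shows "f \<longlonglongrightarrow> 0"
proof (rule tendsto_sandwich[OF _ _ tendsto_const assms(1)])
  show "\<forall>\<^sub>F n in sequentially. f n \<le> g n"
    using assms(2) by (rule eventually_sequentiallyI)
qed (use assms(3) in simp)

lemma unit_seq_eq: "unit_seq n = fps_X ^ n"
  by (rule fps_ext) (simp add: unit_seq_def fps_X_power_nth)

lemma nth_unit_seq [simp]: "fps_nth (unit_seq n) i = (if i = n then 1 else 0)"
  by (simp add: unit_seq_def)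

lemma nth_sum_unit_seq:
  "fps_nth (\<Sum>n<N. fps_const (a n) * unit_seq n) i = (if i < N then a i else 0)"
  by (simp add: fps_sum_nth if_distrib cong: if_cong)

section \<open>Seminorm calculus in the algebra\<close>

context frechet_sequence_algebra
begin

lemma zero_mem [simp]: "0 \<in> X"
  and add_mem [simp]: "x \<in> X \<Longrightarrow> y \<in> X \<Longrightarrow> x + y \<in> X"
  and scale_mem [simp]: "x \<in> X \<Longrightarrow> fps_const c * x \<in> X"
  and mult_mem [simp]: "x \<in> X \<Longrightarrow> y \<in> X \<Longrightarrow> x * y \<in> X"
  using subalgebra by (auto simp: subalgebra_def)

lemma neg_eq_scale: "- x = fps_const (-1) * x" for x :: "complex fps"
  by (simp flip: fps_const_neg)

lemma uminus_mem [simp]: "x \<in> X \<Longrightarrow> - x \<in> X"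
  by (subst neg_eq_scale) (rule scale_mem)

lemma diff_mem [simp]: "x \<in> X \<Longrightarrow> y \<in> X \<Longrightarrow> x - y \<in> X"
  using add_mem[of x "- y"] by simp

lemma sum_mem [simp]: "(\<And>i. i \<in> I \<Longrightarrow> f i \<in> X) \<Longrightarrow> sum f I \<in> X"
  by (induction I rule: infinite_finite_induct) auto

text \<open>Positive powers only, since at this stage \<open>X\<close> need not contain the unit
  \<open>1\<close>.\<close>

lemma power_Suc_mem: "x \<in> X \<Longrightarrow> x ^ Suc k \<in> X"
  by (induction k) auto

lemma power_mem: "x \<in> X \<Longrightarrow> k \<ge> 1 \<Longrightarrow> x ^ k \<in> X"
  using power_Suc_mem[of x "k - 1"] by simp

lemma seminorm_zero [simp]: "q \<ge> 1 \<Longrightarrow> p q 0 = 0"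
  using seminorm_scale[of q 0 0] by simp

lemma seminorm_uminus: "q \<ge> 1 \<Longrightarrow> x \<in> X \<Longrightarrow> p q (- x) = p q x"
  by (subst neg_eq_scale) (simp only: seminorm_scale, simp)

lemma seminorm_minus_commute: "q \<ge> 1 \<Longrightarrow> x \<in> X \<Longrightarrow> y \<in> X \<Longrightarrow> p q (x - y) = p q (y - x)"
  using seminorm_uminus[of q "x - y"] by simp

lemma seminorm_triangle3:
  "q \<ge> 1 \<Longrightarrow> x \<in> X \<Longrightarrow> y \<in> X \<Longrightarrow> z \<in> X \<Longrightarrow> p q (x - z) \<le> p q (x - y) + p q (y - z)"
  using seminorm_triangle[of q "x - y" "y - z"] by simp

lemma seminorm_sum:
  "q \<ge> 1 \<Longrightarrow> (\<And>i. i \<in> I \<Longrightarrow> f i \<in> X) \<Longrightarrow> p q (sum f I) \<le> (\<Sum>i\<in>I. p q (f i))"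
proof (induction I rule: infinite_finite_induct)
  case (insert i I)
  have "p q (f i + sum f I) \<le> p q (f i) + p q (sum f I)"
    using insert.prems by (intro seminorm_triangle) auto
  then show ?case using insert by force
qed auto

text \<open>Telescoping and submultiplicativity make powers Lipschitz on bounded sets.
  \<open>generic_vector\<close> uses this to pass from one good vector to a whole ball around
  it.\<close>

lemma seminorm_power_diff:
  assumes q: "q \<ge> 1" and X: "z \<in> X" "u \<in> X" and R: "p q z \<le> R" "p q u \<le> R"
  shows "p q (z ^ Suc k - u ^ Suc k) \<le> real (Suc k) * R ^ k * p q (z - u)"
proof (induction k)
  case (Suc k)
  have R0: "0 \<le> R" using R seminorm_nonneg[OF q X(1)] by linarith
  have pz: "p q (z ^ Suc k) \<le> R ^ Suc k" for k
  proof (induction k)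
    case (Suc k)
    have "p q (z * z ^ Suc k) \<le> p q z * p q (z ^ Suc k)"
      by (rule seminorm_mult[OF q X(1) power_Suc_mem[OF X(1)]])
    also have "\<dots> \<le> R * R ^ Suc k"
      using Suc R0 R seminorm_nonneg[OF q power_Suc_mem[OF X(1)]] by (intro mult_mono) auto
    finally show ?case by simp
  qed (use R in simp)
  have eq: "z ^ Suc (Suc k) - u ^ Suc (Suc k)
      = (z - u) * z ^ Suc k + u * (z ^ Suc k - u ^ Suc k)"
    by (simp add: algebra_simps)
  note mem = power_Suc_mem[OF X(1), of k] power_Suc_mem[OF X(2), of k]
  have "p q (z ^ Suc (Suc k) - u ^ Suc (Suc k))
      \<le> p q ((z - u) * z ^ Suc k) + p q (u * (z ^ Suc k - u ^ Suc k))"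
    unfolding eq by (rule seminorm_triangle[OF q]) (intro mult_mem diff_mem X mem)+
  also have "\<dots> \<le> p q (z - u) * p q (z ^ Suc k) + p q u * p q (z ^ Suc k - u ^ Suc k)"
    by (intro add_mono seminorm_mult[OF q] diff_mem X mem)
  also have "\<dots> \<le> p q (z - u) * R ^ Suc k + R * (real (Suc k) * R ^ k * p q (z - u))"
    using R0 R Suc pz[of k] seminorm_nonneg[OF q diff_mem[OF X]]
      seminorm_nonneg[OF q diff_mem[OF mem]] seminorm_nonneg[OF q mem(1)]
    by (intro add_mono mult_mono) auto
  also have "\<dots> = real (Suc (Suc k)) * R ^ Suc k * p q (z - u)"
    by (simp add: algebra_simps)
  finally show ?case .
qed (simp)

section \<open>The topology generated by the seminorms\<close>

lemma ball_open:
  "x \<in> X \<Longrightarrow> q \<ge> 1 \<Longrightarrow> \<epsilon> > 0 \<Longrightarrow> openin (seminorm_topology X p) {y \<in> X. p q (y - x) < \<epsilon>}"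
  unfolding seminorm_topology_def by (rule topology_generated_by_Basis) blast

text \<open>Induction over the generated topology. For intersections, monotonicity in the index lets
  the larger of two seminorms and the smaller radius serve both sets.\<close>

lemma open_contains_ball:
  assumes "openin (seminorm_topology X p) U" "x \<in> U"
  obtains q \<epsilon> where "q \<ge> 1" "\<epsilon> > 0" "{y \<in> X. p q (y - x) < \<epsilon>} \<subseteq> U"
proof -
  let ?S = "{{y \<in> X. p q (y - x) < \<epsilon>} | x q \<epsilon>. x \<in> X \<and> q \<ge> 1 \<and> \<epsilon> > 0}"
  have "generate_topology_on ?S U"
    using assms(1) unfolding seminorm_topology_def openin_topology_generated_by_iff .
  then have "\<forall>x\<in>U. \<exists>q\<ge>1. \<exists>\<epsilon>>0. {y \<in> X. p q (y - x) < \<epsilon>} \<subseteq> U"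
  proof induction
    case (Int A B)
    show ?case
    proof
      fix x assume x: "x \<in> A \<inter> B"
      obtain q \<epsilon> where 1: "q \<ge> 1" "\<epsilon> > 0" "{y \<in> X. p q (y - x) < \<epsilon>} \<subseteq> A"
        using Int(3) x by blast
      obtain q' \<epsilon>' where 2: "q' \<ge> 1" "\<epsilon>' > 0" "{y \<in> X. p q' (y - x) < \<epsilon>'} \<subseteq> B"
        using Int(4) x by blast
      have X: "x \<in> X"
      proof -
        have "A \<subseteq> topspace (seminorm_topology X p)"
          using Int(1) unfolding seminorm_topology_def
          by (intro openin_subset) (simp add: openin_topology_generated_by_iff)
        then show ?thesis using x topspace_seminorm_topology by blast
      qed
      have "y \<in> A \<inter> B" if "y \<in> X" "p (max q q') (y - x) < min \<epsilon> \<epsilon>'" for y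
      proof -
        have "p q (y - x) \<le> p (max q q') (y - x)" "p q' (y - x) \<le> p (max q q') (y - x)"
          using 1 2 that X by (auto intro!: seminorm_mono)
        then show ?thesis using 1(3) 2(3) that by auto
      qed
      then show "\<exists>q\<ge>1. \<exists>\<epsilon>>0. {y \<in> X. p q (y - x) < \<epsilon>} \<subseteq> A \<inter> B"
        using 1 2 by (intro exI[of _ "max q q'"] conjI exI[of _ "min \<epsilon> \<epsilon>'"]) auto
    qed
  next
    case (UN K)
    show ?case
    proof
      fix x assume "x \<in> \<Union> K"
      then obtain k where k: "k \<in> K" "x \<in> k" by blast
      then obtain q \<epsilon> where "q \<ge> 1" "\<epsilon> > 0" "{y \<in> X. p q (y - x) < \<epsilon>} \<subseteq> k"
        using UN by blast
      then show "\<exists>q\<ge>1. \<exists>\<epsilon>>0. {y \<in> X. p q (y - x) < \<epsilon>} \<subseteq> \<Union> K" using k by blast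
    qed
  next
    case (Basis S)
    then obtain a q \<epsilon> where S: "a \<in> X" "q \<ge> 1" "\<epsilon> > 0" "S = {y \<in> X. p q (y - a) < \<epsilon>}"
      by blast
    show ?case
    proof
      fix x assume x: "x \<in> S"
      have "y \<in> S" if "y \<in> X" "p q (y - x) < \<epsilon> - p q (x - a)" for y
        using seminorm_triangle3[of q y x a] S x that by auto
      then show "\<exists>q\<ge>1. \<exists>\<epsilon>>0. {y \<in> X. p q (y - x) < \<epsilon>} \<subseteq> S"
        using S x by (intro exI[of _ q] conjI exI[of _ "\<epsilon> - p q (x - a)"]) auto
    qed
  qed auto
  then show thesis using assms(2) that by blast
qed

lemma limitin_seminorm:
  assumes "limitin (seminorm_topology X p) s l sequentially" "range s \<subseteq> X" "q \<ge> 1"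
  shows "l \<in> X" "(\<lambda>n. p q (s n - l)) \<longlonglongrightarrow> 0"
proof -
  show l: "l \<in> X"
    using assms(1) topspace_seminorm_topology by (auto simp: limitin_def)
  show "(\<lambda>n. p q (s n - l)) \<longlonglongrightarrow> 0"
  proof (rule LIMSEQ_I)
    fix r :: real assume r: "r > 0"
    have "l \<in> {y \<in> X. p q (y - l) < r}" using l r assms(3) by simp
    then have "\<forall>\<^sub>F n in sequentially. s n \<in> {y \<in> X. p q (y - l) < r}"
      using assms(1) ball_open[OF l assms(3) r] unfolding limitin_def by blast
    then show "\<exists>N. \<forall>n\<ge>N. norm (p q (s n - l) - 0) < r"
      using seminorm_nonneg[OF assms(3)] l by (fastforce simp: eventually_sequentially)
  qed
qed

section \<open>Baire category, uniform boundedness and coordinate functionals\<close>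

text \<open>Nested closed balls, phrased with seminorms: the hypothesis says that every ball meets
  the interior of each set \<open>G n\<close>. The centres converge to a point of all the
  balls.\<close>

lemma Baire_category:
  fixes G :: "nat \<Rightarrow> complex fps \<Rightarrow> bool"
  assumes dense: "\<And>n x q \<epsilon>. x \<in> X \<Longrightarrow> q \<ge> 1 \<Longrightarrow> \<epsilon> > 0 \<Longrightarrow>
    \<exists>y\<in>X. \<exists>q'\<ge>1. \<exists>\<epsilon>'>0. p q (y - x) < \<epsilon> \<and> (\<forall>z\<in>X. p q' (z - y) \<le> \<epsilon>' \<longrightarrow> G n z)"
  shows "\<exists>x\<in>X. \<forall>n. G n x"
proof -
  \<comment> \<open>A state is a closed ball (centre, seminorm index, radius). Growing indices and
    geometric radii make the centres Cauchy for every seminorm. Stage \<open>0\<close> carries no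
    condition, so stage \<open>n\<close> ensures \<open>G (n - 1)\<close>.\<close>
  define P where "P = (\<lambda>n (x, q, \<epsilon>). x \<in> X \<and> q \<ge> Suc n \<and> \<epsilon> > 0 \<and> \<epsilon> \<le> (1/2) ^ n \<and>
    (\<forall>z\<in>X. p q (z - x) \<le> \<epsilon> \<longrightarrow> n > 0 \<longrightarrow> G (n - 1) z))"
  define Q where "Q = (\<lambda>(x, q, \<epsilon>) (x', q', \<epsilon>'). q \<le> q' \<and> \<epsilon>' \<le> \<epsilon> / 2 \<and> p q (x' - x) \<le> \<epsilon> / 2)"
  have "\<exists>f. \<forall>n. P n (f n) \<and> Q (f n) (f (Suc n))"
  proof (rule dependent_nat_choice)
    show "\<exists>s. P 0 s"
      by (rule exI[of _ "(0, 1, 1)"]) (simp add: P_def)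
  next
    fix s n assume "P n s"
    then obtain x q \<epsilon> where s: "s = (x, q, \<epsilon>)" "x \<in> X" "q \<ge> Suc n" "\<epsilon> > 0" "\<epsilon> \<le> (1/2) ^ n"
      by (cases s) (auto simp: P_def)
    obtain y q' \<epsilon>' where y: "y \<in> X" "q' \<ge> 1" "\<epsilon>' > 0" "p q (y - x) < \<epsilon> / 2"
      "\<And>z. z \<in> X \<Longrightarrow> p q' (z - y) \<le> \<epsilon>' \<Longrightarrow> G n z"
      using dense[of x q "\<epsilon> / 2" n] s by auto
    define q'' where "q'' = q' + q + 1"
    have "G n z" if "z \<in> X" "p q'' (z - y) \<le> min \<epsilon>' (\<epsilon> / 2)" for z
      using seminorm_mono[of q' q'' "z - y"] y that by (intro y(5)) (auto simp: q''_def)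
    then have "P (Suc n) (y, q'', min \<epsilon>' (\<epsilon> / 2)) \<and> Q s (y, q'', min \<epsilon>' (\<epsilon> / 2))"
      using s y by (auto simp: P_def Q_def q''_def)
    then show "\<exists>s'. P (Suc n) s' \<and> Q s s'" by blast
  qed
  then obtain f where f: "\<And>n. P n (f n)" "\<And>n. Q (f n) (f (Suc n))" by blast
  define x q \<epsilon> where "x n = fst (f n)" and "q n = fst (snd (f n))" and "\<epsilon> n = snd (snd (f n))"
    for n
  have feq: "f n = (x n, q n, \<epsilon> n)" for n by (simp add: x_def q_def \<epsilon>_def)
  have x: "x n \<in> X" and q: "q n \<ge> Suc n" and \<epsilon>: "\<epsilon> n > 0" "\<epsilon> n \<le> (1/2) ^ n"
    and G: "\<And>z. z \<in> X \<Longrightarrow> p (q (Suc n)) (z - x (Suc n)) \<le> \<epsilon> (Suc n) \<Longrightarrow> G n z" for n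
    using f(1)[of n] f(1)[of "Suc n"] unfolding feq P_def by auto
  have step: "q n \<le> q (Suc n)" "\<epsilon> (Suc n) \<le> \<epsilon> n / 2" "p (q n) (x (Suc n) - x n) \<le> \<epsilon> n / 2" for n
    using f(2)[of n] unfolding feq Q_def by auto
  have q1: "q n \<ge> 1" for n using q[of n] by linarith
  \<comment> \<open>One step moves the centre by at most \<open>\<epsilon> n / 2\<close>, and all
    later ones together by at most \<open>\<epsilon> (Suc n)\<close>, which is again at most
    \<open>\<epsilon> n / 2\<close>.\<close>
  have nest: "p (q n) (x (n + k) - x n) \<le> \<epsilon> n" for n k
  proof (induction k arbitrary: n)
    case 0
    then show ?case using q1 \<epsilon>(1)[of n] by simp
  next
    case (Suc k)
    have "p (q n) (x (Suc n + k) - x (Suc n)) \<le> p (q (Suc n)) (x (Suc n + k) - x (Suc n))"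
      by (rule seminorm_mono[OF q1 step(1)]) (simp add: x)
    with Suc[of "Suc n"] step[of n] seminorm_triangle3[OF q1[of n] x[of "Suc n + k"] x[of "Suc n"] x[of n]]
    show ?case by simp
  qed
  have "\<exists>l\<in>X. limitin (seminorm_topology X p) x l sequentially"
  proof (rule complete)
    show "range x \<subseteq> X" using x by blast
    fix r :: nat and e :: real assume r: "r \<ge> 1" and e: "e > 0"
    obtain N0 where N0: "(1/2) ^ N0 < e / 2"
      using real_arch_pow_inv[of "e/2" "1/2"] e by auto
    \<comment> \<open>The bound \<open>N \<ge> r\<close> gives \<open>q N \<ge> r\<close>, so that
      \<open>p r\<close> is dominated by the seminorm of the \<open>N\<close>-th ball.\<close>
    define N where "N = max N0 r"
    have "(1/2::real) ^ N \<le> (1/2) ^ N0" by (rule power_decreasing) (auto simp: N_def)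
    then have eN: "\<epsilon> N < e / 2" using \<epsilon>(2)[of N] N0 by linarith
    have *: "p r (x m - x N) < e / 2" if "m \<ge> N" for m
    proof -
      have "p r (x m - x N) \<le> p (q N) (x m - x N)"
        by (rule seminorm_mono[OF r]) (use q[of N] x in \<open>auto simp: N_def\<close>)
      then show ?thesis using nest[of N "m - N"] that eN by simp
    qed
    have "p r (x m - x n) < e" if "m \<ge> N" "n \<ge> N" for m n
      using *[OF that(1)] *[OF that(2)] seminorm_triangle3[OF r x[of m] x[of N] x[of n]]
        seminorm_minus_commute[OF r x[of N] x[of n]] by linarith
    then show "\<exists>N. \<forall>m\<ge>N. \<forall>n\<ge>N. p r (x m - x n) < e" by blast
  qed
  then obtain l where l: "l \<in> X" "limitin (seminorm_topology X p) x l sequentially" by blast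
  \<comment> \<open>The estimate \<open>nest\<close> survives the limit as a non-strict inequality;
    this is why \<open>G n\<close> is required on closed balls.\<close>
  have "p (q n) (l - x n) \<le> \<epsilon> n" for n
  proof -
    have "(\<lambda>m. p (q n) (x m - l) + \<epsilon> n) \<longlonglongrightarrow> 0 + \<epsilon> n"
      by (intro tendsto_add tendsto_const limitin_seminorm(2)[OF l(2)] q1) (use x in blast)
    moreover have "\<forall>\<^sub>F m in sequentially. p (q n) (l - x n) \<le> p (q n) (x m - l) + \<epsilon> n"
    proof (rule eventually_sequentiallyI)
      fix m assume "m \<ge> n"
      then show "p (q n) (l - x n) \<le> p (q n) (x m - l) + \<epsilon> n"
        using nest[of n "m - n"] seminorm_triangle3[OF q1[of n] l(1) x[of m] x[of n]]
          seminorm_minus_commute[OF q1[of n] l(1) x[of m]] by simp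
    qed
    ultimately show ?thesis
      using tendsto_lowerbound[of _ "0 + \<epsilon> n"] by fastforce
  qed
  then show ?thesis using G l(1) by blast
qed

text \<open>Banach-Steinhaus for a sequence of continuous seminorms. If no common bound exists, the
  open sets where some \<open>\<phi> i\<close> exceeds \<open>n\<close> are dense, and a point in
  all of them contradicts pointwise boundedness.\<close>

lemma uniform_boundedness:
  fixes \<phi> :: "nat \<Rightarrow> complex fps \<Rightarrow> real"
  assumes add: "\<And>i x y. x \<in> X \<Longrightarrow> y \<in> X \<Longrightarrow> \<phi> i (x + y) \<le> \<phi> i x + \<phi> i y"
    and scale: "\<And>i c x. x \<in> X \<Longrightarrow> \<phi> i (fps_const c * x) = norm c * \<phi> i x"
    and cont: "\<And>i. \<exists>q\<ge>1. \<exists>C. \<forall>x\<in>X. \<phi> i x \<le> C * p q x"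
    and bounded: "\<And>x. x \<in> X \<Longrightarrow> \<exists>B. \<forall>i. \<phi> i x \<le> B"
  obtains q C where "q \<ge> 1" "C > 0" "\<And>i x. x \<in> X \<Longrightarrow> \<phi> i x \<le> C * p q x"
proof (rule ccontr)
  note thesisI = that
  assume not: "\<not> thesis"
  have unbdd: "\<exists>i. \<exists>x\<in>X. \<phi> i x > C * p q x" if qC: "q \<ge> 1" "C > 0"
    for q :: nat and C :: real
  proof (rule ccontr)
    assume "\<not> ?thesis"
    then have "\<And>i x. x \<in> X \<Longrightarrow> \<phi> i x \<le> C * p q x" using not_le by blast
    from thesisI[OF qC this] not show False by blast
  qed
  have neg: "\<phi> i (- x) = \<phi> i x" if "x \<in> X" for i x
    by (subst neg_eq_scale) (simp only: scale[OF that], simp)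
  have "\<exists>x\<in>X. \<forall>n. \<exists>i. \<phi> i x > real n"
  proof (rule Baire_category)
    fix n q :: nat and x and \<epsilon> :: real assume x: "x \<in> X" and q: "q \<ge> 1" and \<epsilon>: "\<epsilon> > 0"
    have "\<exists>y\<in>X. p q (y - x) < \<epsilon> \<and> (\<exists>i. \<phi> i y > real n)"
    proof (rule ccontr)
      assume "\<not> ?thesis"
      then have le: "\<phi> i y \<le> real n" if "y \<in> X" "p q (y - x) < \<epsilon>" for i y
        using that not_le by blast
      \<comment> \<open>Translation to the origin: \<open>h\<close> is the difference of
        \<open>x + h\<close> and \<open>x\<close>, both in the ball where every
        \<open>\<phi> i\<close> is at most \<open>n\<close>.\<close>
      have small: "\<phi> i h \<le> 2 * real n" if h: "h \<in> X" "p q h < \<epsilon>" for i h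
      proof -
        have "\<phi> i ((x + h) + (- x)) \<le> \<phi> i (x + h) + \<phi> i (- x)"
          using x h by (intro add) auto
        then show ?thesis
          using le[of "x + h" i] le[of x i] neg[of x i] x h q \<epsilon> by simp
      qed
      have "\<phi> i h \<le> (4 * real n + 1) / \<epsilon> * p q h" if h: "h \<in> X" for i h
      proof (rule field_le_epsilon)
        fix e :: real assume e: "e > 0"
        \<comment> \<open>The summand \<open>1\<close> keeps \<open>K\<close> positive for
          \<open>n = 0\<close>. As \<open>p q h\<close> may vanish, \<open>h\<close> is normalised
          by \<open>p q h + e / K\<close> instead, which costs only \<open>e\<close> in the
          end.\<close>
        define K where "K = (4 * real n + 1) / \<epsilon>"
        have K: "K > 0" using \<epsilon> by (simp add: K_def)
        define s where "s = p q h + e / K"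
        define c where "c = \<epsilon> / (2 * s)"
        have ph: "p q h \<ge> 0" by (rule seminorm_nonneg[OF q h])
        have pos: "s > 0" using e K ph by (simp add: s_def add_nonneg_pos)
        have c: "c > 0" using \<epsilon> pos by (simp add: c_def)
        have "c * p q h \<le> c * s" using c e K by (simp add: s_def)
        also have "\<dots> = \<epsilon> / 2" using pos by (simp add: c_def)
        finally have "p q (fps_const (of_real c) * h) < \<epsilon>"
          using seminorm_scale[OF q h, of "of_real c"] c \<epsilon> by simp
        then have "c * \<phi> i h \<le> 2 * real n"
          using small[of "fps_const (of_real c) * h" i] h scale[OF h, of i "of_real c"] c by simp
        then have "\<phi> i h \<le> 2 * real n / c" using c by (simp add: field_simps)
        also have "\<dots> = (4 * real n) / \<epsilon> * s"
          using pos \<epsilon> by (simp add: c_def field_simps)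
        also have "\<dots> \<le> K * s"
          unfolding K_def using pos \<epsilon> by (intro mult_right_mono divide_right_mono) auto
        also have "\<dots> = K * p q h + e" using K by (simp add: s_def field_simps)
        finally show "\<phi> i h \<le> (4 * real n + 1) / \<epsilon> * p q h + e" by (simp add: K_def)
      qed
      moreover have "(4 * real n + 1) / \<epsilon> > 0" using \<epsilon> by simp
      ultimately show False using unbdd[OF q] by (meson not_le)
    qed
    then obtain y i where y: "y \<in> X" "p q (y - x) < \<epsilon>" "\<phi> i y > real n" by blast
    obtain q' C where q': "q' \<ge> 1" and C: "\<And>x. x \<in> X \<Longrightarrow> \<phi> i x \<le> C * p q' x"
      using cont[of i] by blast
    \<comment> \<open>The constant from \<open>cont\<close> may have any sign; \<open>D\<close> is
      positive and can be divided by.\<close>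
    define D where "D = \<bar>C\<bar> + 1"
    have D: "D > 0" by (simp add: D_def)
    have CD: "C * p q' z \<le> D * p q' z" if "z \<in> X" for z
      using seminorm_nonneg[OF q' that] by (intro mult_right_mono) (auto simp: D_def)
    \<comment> \<open>On this ball \<open>\<phi> i\<close> drops by at most half of its excess over
      \<open>n\<close>.\<close>
    define \<epsilon>' where "\<epsilon>' = (\<phi> i y - real n) / (2 * D)"
    have \<epsilon>': "\<epsilon>' > 0" using y D by (simp add: \<epsilon>'_def)
    have "\<phi> i z > real n" if z: "z \<in> X" "p q' (z - y) \<le> \<epsilon>'" for z
    proof -
      have "\<phi> i (z + (y - z)) \<le> \<phi> i z + \<phi> i (y - z)" using z y by (intro add) auto
      moreover have "\<phi> i (y - z) = \<phi> i (z - y)" using neg[of "z - y" i] z y by simp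
      moreover have "\<phi> i (z - y) \<le> D * p q' (z - y)"
        using C[of "z - y"] CD[of "z - y"] z y by simp
      moreover have "D * p q' (z - y) \<le> D * \<epsilon>'" using z D by simp
      moreover have "D * \<epsilon>' = (\<phi> i y - real n) / 2" using D by (simp add: \<epsilon>'_def)
      ultimately show ?thesis using y by simp
    qed
    then show "\<exists>y\<in>X. \<exists>q'\<ge>1. \<exists>\<epsilon>'>0. p q (y - x) < \<epsilon> \<and>
        (\<forall>z\<in>X. p q' (z - y) \<le> \<epsilon>' \<longrightarrow> (\<exists>i. \<phi> i z > real n))"
      using y q' \<epsilon>' by blast
  qed
  then obtain x where x: "x \<in> X" "\<And>n. \<exists>i. \<phi> i x > real n" by blast
  obtain B where B: "\<And>i. \<phi> i x \<le> B" using bounded[OF x(1)] by blast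
  obtain n where "B < real n" using reals_Archimedean2 by blast
  then show False using x(2)[of n] B by (meson less_le_trans not_less order.strict_trans)
qed

text \<open>Some seminorm ball around \<open>0\<close> is mapped into the unit disc. A vector
  violating the bound, rescaled to have \<open>n\<close>-th coordinate \<open>1\<close>, would still
  lie in that ball.\<close>

lemma coordinate_bound:
  obtains q C where "q \<ge> 1" "C > 0" "\<And>x. x \<in> X \<Longrightarrow> norm (fps_nth x n) \<le> C * p q x"
proof -
  have "continuous_map (seminorm_topology X p) euclidean (\<lambda>x. fps_nth x n)"
    using continuous_map_compose[OF continuous_embedding
        continuous_map_product_projection[of n UNIV "\<lambda>_. euclidean"]]
    by (simp add: o_def)
  then have "openin (seminorm_topology X p)
      {x \<in> topspace (seminorm_topology X p). fps_nth x n \<in> ball 0 1}"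
    by (rule openin_continuous_map_preimage) simp
  then obtain q \<epsilon> where q: "q \<ge> 1" "\<epsilon> > 0"
    "{y \<in> X. p q (y - 0) < \<epsilon>} \<subseteq> {x \<in> topspace (seminorm_topology X p). fps_nth x n \<in> ball 0 1}"
    by (rule open_contains_ball[where x = 0]) (auto simp: topspace_seminorm_topology)
  have small: "norm (fps_nth x n) < 1" if "x \<in> X" "p q x < \<epsilon>" for x
    using q(3) that by auto
  have "norm (fps_nth x n) \<le> 1 / \<epsilon> * p q x" if x: "x \<in> X" for x
  proof (rule ccontr)
    assume "\<not> ?thesis"
    then have gt: "p q x < \<epsilon> * norm (fps_nth x n)" using q(2) by (simp add: field_simps)
    then have nz: "norm (fps_nth x n) > 0"
      using seminorm_nonneg[OF q(1) x] q(2) by (smt (verit) zero_less_mult_pos)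
    let ?c = "inverse (fps_nth x n)"
    have "p q x / norm (fps_nth x n) < \<epsilon>" using gt nz by (simp add: field_simps)
    then have "p q (fps_const ?c * x) < \<epsilon>"
      using seminorm_scale[OF q(1) x, of ?c] by (simp add: norm_inverse divide_inverse mult.commute)
    from small[OF scale_mem[OF x] this] nz show False by simp
  qed
  then show thesis using that[of q "1 / \<epsilon>"] q by simp
qed

end


section \<open>Basis expansions and automatic continuity\<close>

text \<open>Formed with the coordinates of \<open>x\<close> instead of the coefficients supplied by
  \<open>schauder_basis\<close>; \<open>partial_sum_tendsto\<close> identifies the two.\<close>

definition partial_sum :: "nat \<Rightarrow> complex fps \<Rightarrow> complex fps" where
  "partial_sum N x = (\<Sum>n<N. fps_const (fps_nth x n) * unit_seq n)"

lemma nth_partial_sum: "fps_nth (partial_sum N x) i = (if i < N then fps_nth x i else 0)"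
  by (simp add: partial_sum_def nth_sum_unit_seq)

lemma partial_sum_add: "partial_sum N (x + y) = partial_sum N x + partial_sum N y"
  and partial_sum_scale: "partial_sum N (fps_const c * x) = fps_const c * partial_sum N x"
  by (rule fps_ext, simp add: nth_partial_sum)+

locale frechet_sequence_algebra_basis = frechet_sequence_algebra +
  assumes basis: "schauder_basis X p unit_seq"
begin

lemma unit_seq_mem [simp]: "unit_seq n \<in> X"
  using basis by (auto simp: schauder_basis_def)

lemma partial_sum_mem [simp]: "partial_sum N x \<in> X"
  by (simp add: partial_sum_def)

text \<open>The \<open>k\<close>-th coordinate of the \<open>N\<close>-th sum of the basis expansion
  is \<open>a k\<close> as soon as \<open>N > k\<close>; continuity of coordinates then forces
  \<open>a k = fps_nth x k\<close>.\<close>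

lemma partial_sum_tendsto:
  assumes x: "x \<in> X" and r: "r \<ge> 1"
  shows "(\<lambda>N. p r (partial_sum N x - x)) \<longlonglongrightarrow> 0"
proof -
  obtain a where a: "limitin (seminorm_topology X p) (\<lambda>N. \<Sum>n<N. fps_const (a n) * unit_seq n)
      x sequentially"
    using basis x unfolding schauder_basis_def by blast
  define s where "s N = (\<Sum>n<N. fps_const (a n) * unit_seq n)" for N
  have s: "s N \<in> X" for N by (simp add: s_def)
  have lim: "(\<lambda>N. p q (s N - x)) \<longlonglongrightarrow> 0" if "q \<ge> 1" for q
    using limitin_seminorm(2)[OF a[folded s_def] _ that] s by blast
  have "a k = fps_nth x k" for k
  proof -
    obtain q C where q: "q \<ge> 1" "\<And>x. x \<in> X \<Longrightarrow> norm (fps_nth x k) \<le> C * p q x"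
      using coordinate_bound[of k] by metis
    have "(\<lambda>N. C * p q (s N - x)) \<longlonglongrightarrow> C * 0"
      by (intro tendsto_mult tendsto_const lim q)
    moreover have "\<forall>\<^sub>F N in sequentially. norm (a k - fps_nth x k) \<le> C * p q (s N - x)"
    proof (rule eventually_sequentiallyI)
      fix N assume "N \<ge> Suc k"
      then show "norm (a k - fps_nth x k) \<le> C * p q (s N - x)"
        using q(2)[of "s N - x"] s x by (simp add: s_def nth_sum_unit_seq)
    qed
    ultimately have "norm (a k - fps_nth x k) \<le> C * 0"
      using tendsto_lowerbound sequentially_bot by blast
    then show ?thesis by simp
  qed
  then have "s N = partial_sum N x" for N by (simp add: s_def partial_sum_def)
  then show ?thesis using lim[OF r] by simp
qed

lemma partial_sum_bounded:
  assumes "x \<in> X" "r \<ge> 1"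
  shows "\<exists>B. \<forall>N. p r (partial_sum N x) \<le> B"
proof -
  have "Bseq (\<lambda>N. p r (partial_sum N x - x))"
    using partial_sum_tendsto[OF assms] by (intro convergent_imp_Bseq convergentI)
  then obtain K where K: "\<And>N. norm (p r (partial_sum N x - x)) \<le> K"
    by (auto simp: Bseq_def)
  have "p r (partial_sum N x) \<le> K + p r x" for N
    using K[of N] seminorm_triangle[of r "partial_sum N x - x" x] assms by force
  then show ?thesis by blast
qed

text \<open>The \<open>n\<close>-th term of the expansion of \<open>x\<close> is a difference of two
  consecutive partial sums, hence bounded in \<open>n\<close> for fixed \<open>x\<close>. Uniform
  boundedness removes the dependence on \<open>x\<close>.\<close>

lemma coordinate_projection_equicontinuous:
  assumes r: "r \<ge> 1"
  obtains q C where "q \<ge> 1" "C > 0"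
    "\<And>n x. x \<in> X \<Longrightarrow> norm (fps_nth x n) * p r (unit_seq n) \<le> C * p q x"
proof (rule uniform_boundedness)
  have nonneg: "p r (unit_seq n) \<ge> 0" for n by (rule seminorm_nonneg[OF r unit_seq_mem])
  fix i :: nat and x y :: "complex fps" and c :: complex
  show "norm (fps_nth (x + y) i) * p r (unit_seq i)
      \<le> norm (fps_nth x i) * p r (unit_seq i) + norm (fps_nth y i) * p r (unit_seq i)"
    unfolding distrib_right[symmetric] fps_add_nth
    by (intro mult_right_mono norm_triangle_ineq nonneg)
  show "norm (fps_nth (fps_const c * x) i) * p r (unit_seq i)
      = norm c * (norm (fps_nth x i) * p r (unit_seq i))"
    by (simp add: norm_mult)
  obtain q C where q: "q \<ge> 1" "\<And>x. x \<in> X \<Longrightarrow> norm (fps_nth x i) \<le> C * p q x"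
    using coordinate_bound[of i] by metis
  show "\<exists>q\<ge>1. \<exists>C. \<forall>x\<in>X. norm (fps_nth x i) * p r (unit_seq i) \<le> C * p q x"
    using mult_right_mono[OF q(2) nonneg[of i]] q(1)
    by (intro exI[of _ q] conjI exI[of _ "C * p r (unit_seq i)"]) (auto simp: mult_ac)
  assume x: "x \<in> X"
  obtain B where B: "\<And>N. p r (partial_sum N x) \<le> B"
    using partial_sum_bounded[OF x r] by blast
  have "norm (fps_nth x n) * p r (unit_seq n) \<le> B + B" for n
  proof -
    have "norm (fps_nth x n) * p r (unit_seq n) = p r (fps_const (fps_nth x n) * unit_seq n)"
      by (simp add: seminorm_scale[OF r])
    also have "fps_const (fps_nth x n) * unit_seq n
        = partial_sum (Suc n) x + (- partial_sum n x)"
      by (simp add: partial_sum_def)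
    also have "p r \<dots> \<le> p r (partial_sum (Suc n) x) + p r (- partial_sum n x)"
      by (intro seminorm_triangle[OF r]) auto
    finally show ?thesis
      using B[of n] B[of "Suc n"] seminorm_uminus[OF r, of "partial_sum n x"] by simp
  qed
  then show "\<exists>B. \<forall>i. norm (fps_nth x i) * p r (unit_seq i) \<le> B" by blast
qed (use that in blast)

text \<open>A closed graph theorem: \<open>A x\<close> is the limit of its partial sums, each of which depends
  continuously on \<open>x\<close>.\<close>

lemma continuous_if_coordinates_continuous:
  assumes A: "\<And>x. x \<in> X \<Longrightarrow> A x \<in> X"
    and add: "\<And>x y. A (x + y) = A x + A y"
    and scale: "\<And>c x. A (fps_const c * x) = fps_const c * A x"
    and coord: "\<And>n. \<exists>q\<ge>1. \<exists>C. \<forall>x\<in>X. norm (fps_nth (A x) n) \<le> C * p q x"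
    and r: "r \<ge> 1"
  obtains q C where "q \<ge> 1" "C > 0" "\<And>x. x \<in> X \<Longrightarrow> p r (A x) \<le> C * p q x"
proof -
  obtain q C where q: "q \<ge> 1" "C > 0"
    and le: "\<And>N x. x \<in> X \<Longrightarrow> p r (partial_sum N (A x)) \<le> C * p q x"
  proof (rule uniform_boundedness)
    fix N :: nat and x y :: "complex fps" and c :: complex
    show "p r (partial_sum N (A (x + y))) \<le> p r (partial_sum N (A x)) + p r (partial_sum N (A y))"
      unfolding add partial_sum_add by (intro seminorm_triangle[OF r]) auto
    show "p r (partial_sum N (A (fps_const c * x))) = norm c * p r (partial_sum N (A x))"
      unfolding scale partial_sum_scale by (intro seminorm_scale[OF r]) auto
    show "\<exists>B. \<forall>N. p r (partial_sum N (A x)) \<le> B" if "x \<in> X"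
      using partial_sum_bounded[OF A[OF that] r] .
    \<comment> \<open>Here the seminorm and the constant may depend on \<open>N\<close>; it is
      \<open>uniform_boundedness\<close> that makes them uniform.\<close>
    show "\<exists>q\<ge>1. \<exists>C. \<forall>x\<in>X. p r (partial_sum N (A x)) \<le> C * p q x"
    proof (induction N)
      case 0
      then show ?case using r by (intro exI[of _ 1] conjI exI[of _ 0]) (auto simp: partial_sum_def)
    next
      case (Suc N)
      obtain q C where q: "q \<ge> 1" "\<And>x. x \<in> X \<Longrightarrow> p r (partial_sum N (A x)) \<le> C * p q x"
        using Suc by blast
      obtain q' C' where q': "q' \<ge> 1" "\<And>x. x \<in> X \<Longrightarrow> norm (fps_nth (A x) N) \<le> C' * p q' x"
        using coord by blast
      define Q where "Q = max q q'"
      define D where "D = \<bar>C\<bar> + \<bar>C'\<bar> * p r (unit_seq N)"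
      have "p r (partial_sum (Suc N) (A x)) \<le> D * p Q x" if x: "x \<in> X" for x
      proof -
        have nonneg: "p r (unit_seq N) \<ge> 0" by (rule seminorm_nonneg[OF r unit_seq_mem])
        have mono: "p q x \<le> p Q x" "p q' x \<le> p Q x" "0 \<le> p q x" "0 \<le> p q' x"
          using q(1) q'(1) x by (auto simp: Q_def intro!: seminorm_mono seminorm_nonneg)
        have "p r (partial_sum (Suc N) (A x))
            \<le> p r (partial_sum N (A x)) + p r (fps_const (fps_nth (A x) N) * unit_seq N)"
          unfolding partial_sum_def sum.lessThan_Suc by (intro seminorm_triangle[OF r]) auto
        also have "p r (fps_const (fps_nth (A x) N) * unit_seq N)
            = norm (fps_nth (A x) N) * p r (unit_seq N)"
          by (intro seminorm_scale[OF r]) auto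
        also have "p r (partial_sum N (A x)) \<le> \<bar>C\<bar> * p Q x"
          using q(2)[OF x] mono by (meson abs_ge_self abs_ge_zero mult_mono order_trans)
        also have "norm (fps_nth (A x) N) \<le> \<bar>C'\<bar> * p Q x"
          using q'(2)[OF x] mono by (meson abs_ge_self abs_ge_zero mult_mono order_trans)
        finally show ?thesis
          using nonneg by (simp add: D_def algebra_simps mult_right_mono)
      qed
      moreover have "Q \<ge> 1" using q by (simp add: Q_def)
      ultimately show ?case by blast
    qed
  qed (use that in blast)
  have "p r (A x) \<le> C * p q x" if x: "x \<in> X" for x
  proof -
    have "(\<lambda>N. p r (partial_sum N (A x) - A x) + C * p q x) \<longlonglongrightarrow> 0 + C * p q x"
      by (intro tendsto_add tendsto_const partial_sum_tendsto A x r)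
    moreover have "p r (A x) \<le> p r (partial_sum N (A x) - A x) + C * p q x" for N
      using le[OF x, of N] seminorm_triangle3[OF r A[OF x] partial_sum_mem zero_mem, of N "A x"]
        seminorm_minus_commute[OF r A[OF x] partial_sum_mem, of N "A x"] by simp
    ultimately show ?thesis
      using tendsto_lowerbound[of _ "0 + C * p q x"] by fastforce
  qed
  then show thesis using that q by blast
qed

end

section \<open>Iterates of the weighted shift and the consequence of mixing\<close>

locale frechet_sequence_algebra_shift = frechet_sequence_algebra_basis +
  fixes w :: "nat \<Rightarrow> complex"
  assumes weight: "is_weight w"
    and shift_maps: "weighted_backward_shift w ` X \<subseteq> X"
    and shift_mixing: "mixing (seminorm_topology X p) (weighted_backward_shift w)"
begin

abbreviation T :: "complex fps \<Rightarrow> complex fps" where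
  "T \<equiv> weighted_backward_shift w"

definition v :: "nat \<Rightarrow> complex" where
  "v n = inverse (\<Prod>k<n. w (Suc k))"

lemma v_nonzero [simp]: "v n \<noteq> 0"
  using weight by (simp add: v_def is_weight_def)

lemma v_Suc: "v (Suc n) * w (Suc n) = v n"
  using weight by (simp add: v_def is_weight_def)

text \<open>The product of the weights with indices \<open>i + 1\<close> to \<open>i + N\<close>
  telescopes to \<open>v i / v (i + N)\<close>.\<close>

lemma nth_funpow_shift: "fps_nth ((T ^^ N) x) i = v i / v (i + N) * fps_nth x (i + N)"
proof (induction N arbitrary: i)
  case (Suc N)
  have "v i / v (i + Suc N) = w (Suc i) * (v (Suc i) / v (Suc i + N))"
    using v_Suc[of i] by (simp add: field_simps)
  then show ?case using Suc[of "Suc i"] by (simp add: weighted_backward_shift_def)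
qed simp

lemma funpow_shift_add: "(T ^^ N) (x + y) = (T ^^ N) x + (T ^^ N) y"
  and funpow_shift_diff: "(T ^^ N) (x - y) = (T ^^ N) x - (T ^^ N) y"
  and funpow_shift_scale: "(T ^^ N) (fps_const c * x) = fps_const c * (T ^^ N) x"
  and funpow_shift_zero: "(T ^^ N) 0 = 0"
  by (rule fps_ext, simp add: nth_funpow_shift algebra_simps)+

lemma funpow_shift_sum: "(T ^^ N) (sum f I) = (\<Sum>i\<in>I. (T ^^ N) (f i))"
  by (induction I rule: infinite_finite_induct) (auto simp: funpow_shift_add funpow_shift_zero)

lemma funpow_shift_mem [simp]: "x \<in> X \<Longrightarrow> (T ^^ N) x \<in> X"
  using shift_maps by (induction N) auto

text \<open>Only invariance of \<open>X\<close> is assumed. Each coordinate of the image is a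
  multiple of one coordinate of \<open>x\<close>, so the closed graph argument applies.\<close>

lemma funpow_shift_continuous:
  assumes r: "r \<ge> 1"
  obtains q C where "q \<ge> 1" "C > 0" "\<And>x. x \<in> X \<Longrightarrow> p r ((T ^^ N) x) \<le> C * p q x"
proof (rule continuous_if_coordinates_continuous[where A = "T ^^ N", OF _ _ _ _ r])
  fix n
  obtain q C where q: "q \<ge> 1" "\<And>x. x \<in> X \<Longrightarrow> norm (fps_nth x (n + N)) \<le> C * p q x"
    using coordinate_bound[of "n + N"] by metis
  have "norm (fps_nth ((T ^^ N) x) n) \<le> (norm (v n / v (n + N)) * C) * p q x" if "x \<in> X" for x
    using mult_left_mono[OF q(2)[OF that], of "norm (v n / v (n + N))"]
    by (simp add: nth_funpow_shift norm_mult norm_divide mult_ac)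
  then show "\<exists>q\<ge>1. \<exists>C. \<forall>x\<in>X. norm (fps_nth ((T ^^ N) x) n) \<le> C * p q x"
    using q(1) by blast
qed (use that in \<open>auto simp: funpow_shift_add funpow_shift_scale\<close>)

text \<open>One seminorm and one constant for all iterates up to \<open>M\<close>: in
  \<open>perturbation_tendsto_zero\<close> the shift length varies within this range.\<close>

lemma funpow_shift_equicontinuous:
  assumes r: "r \<ge> 1"
  obtains q C where "q \<ge> 1" "C > 0" "\<And>N x. N \<le> M \<Longrightarrow> x \<in> X \<Longrightarrow> p r ((T ^^ N) x) \<le> C * p q x"
proof -
  have "\<exists>q\<ge>1. \<exists>C>0. \<forall>N\<le>M. \<forall>x\<in>X. p r ((T ^^ N) x) \<le> C * p q x"
  proof (induction M)
    case 0
    then show ?case using r by (intro exI[of _ r] conjI exI[of _ 1]) auto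
  next
    case (Suc M)
    then obtain q C where q: "q \<ge> 1" "C > 0"
      "\<And>N x. N \<le> M \<Longrightarrow> x \<in> X \<Longrightarrow> p r ((T ^^ N) x) \<le> C * p q x" by blast
    obtain q' C' where q': "q' \<ge> 1" "C' > 0" "\<And>x. x \<in> X \<Longrightarrow> p r ((T ^^ Suc M) x) \<le> C' * p q' x"
      using funpow_shift_continuous[OF r, of "Suc M"] by blast
    have "p r ((T ^^ N) x) \<le> max C C' * p (max q q') x" if "N \<le> Suc M" "x \<in> X" for N x
    proof -
      have mono: "p q x \<le> p (max q q') x" "p q' x \<le> p (max q q') x"
        "0 \<le> p q x" "0 \<le> p q' x"
        using q(1) q'(1) that by (auto intro!: seminorm_mono seminorm_nonneg)
      have "C * p q x \<le> max C C' * p (max q q') x" "C' * p q' x \<le> max C C' * p (max q q') x"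
        using q(2) q'(2) mono by (intro mult_mono; simp)+
      then show ?thesis
        using q(3)[of N x] q'(3)[of x] that by (cases "N = Suc M") force+
    qed
    then show ?case
      using q q' by (intro exI[of _ "max q q'"] conjI exI[of _ "max C C'"]) auto
  qed
  then show thesis using that by blast
qed

text \<open>For all large \<open>n\<close> mixing gives \<open>u\<close> near \<open>0\<close> with
  \<open>(T ^^ n) u\<close> near \<open>unit_seq 0\<close>. Then \<open>v n\<close> is at most twice
  the \<open>n\<close>-th coordinate of \<open>u\<close> in modulus, and the \<open>n\<close>-th
  term of \<open>u\<close> is small uniformly in \<open>n\<close>.\<close>

lemma mixing_imp_tendsto_zero:
  assumes r: "r \<ge> 1"
  shows "(\<lambda>n. norm (v n) * p r (unit_seq n)) \<longlonglongrightarrow> 0"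
proof (rule LIMSEQ_I)
  fix \<epsilon> :: real assume \<epsilon>: "\<epsilon> > 0"
  obtain q C where q: "q \<ge> 1" "C > 0"
    and C: "\<And>n x. x \<in> X \<Longrightarrow> norm (fps_nth x n) * p r (unit_seq n) \<le> C * p q x"
    using coordinate_projection_equicontinuous[OF r] by blast
  obtain q0 C0 where q0: "q0 \<ge> 1" "C0 > 0"
    and C0: "\<And>x. x \<in> X \<Longrightarrow> norm (fps_nth x 0) \<le> C0 * p q0 x"
    using coordinate_bound[of 0] by blast
  define U where "U = {y \<in> X. p q (y - 0) < \<epsilon> / (2 * C)}"
  define V where "V = {y \<in> X. p q0 (y - unit_seq 0) < 1 / (2 * C0)}"
  have "openin (seminorm_topology X p) U" "openin (seminorm_topology X p) V"
    unfolding U_def V_def using q q0 \<epsilon> by (intro ball_open; simp)+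
  moreover have "0 \<in> U" "unit_seq 0 \<in> V"
    using q q0 \<epsilon> by (auto simp: U_def V_def)
  ultimately have "finite (- {n. (T ^^ n) ` U \<inter> V \<noteq> {}})"
    using shift_mixing unfolding mixing_def by blast
  then obtain n0 where n0: "\<And>n. n \<in> - {n. (T ^^ n) ` U \<inter> V \<noteq> {}} \<Longrightarrow> n \<le> n0"
    by (meson finite_nat_set_iff_bounded_le)
  have "norm (v n) * p r (unit_seq n) < \<epsilon>" if "n > n0" for n
  proof -
    obtain u where u: "u \<in> U" "(T ^^ n) u \<in> V" using n0[of n] \<open>n > n0\<close> by fastforce
    have "norm (fps_nth ((T ^^ n) u - unit_seq 0) 0) \<le> C0 * p q0 ((T ^^ n) u - unit_seq 0)"
      by (rule C0) (use u in \<open>auto simp: V_def\<close>)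
    also have "\<dots> < C0 * (1 / (2 * C0))"
      using u q0 by (intro mult_strict_left_mono) (auto simp: V_def)
    also have "\<dots> = 1 / 2" using q0 by simp
    \<comment> \<open>As \<open>v 0 = 1\<close>, coordinate \<open>0\<close> of
      \<open>(T ^^ n) u\<close> is \<open>fps_nth u n / v n\<close>.\<close>
    finally have "norm (fps_nth u n / v n - 1) < 1 / 2"
      by (simp add: nth_funpow_shift v_def)
    then have "norm (fps_nth u n / v n) > 1 / 2"
      using norm_triangle_ineq2[of 1 "fps_nth u n / v n"] by (simp add: norm_minus_commute)
    then have "norm (v n) \<le> 2 * norm (fps_nth u n)" by (simp add: norm_divide field_simps)
    then have "norm (v n) * p r (unit_seq n) \<le> 2 * (norm (fps_nth u n) * p r (unit_seq n))"
      using mult_right_mono[OF _ seminorm_nonneg[OF r unit_seq_mem[of n]]] by fastforce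
    also have "\<dots> \<le> 2 * (C * p q u)" using C u by (auto simp: U_def)
    also have "\<dots> < \<epsilon>" using u q by (auto simp: U_def field_simps)
    finally show ?thesis .
  qed
  then show "\<exists>N. \<forall>n\<ge>N. norm (norm (v n) * p r (unit_seq n) - 0) < \<epsilon>"
    using seminorm_nonneg[OF r unit_seq_mem] by (intro exI[of _ "Suc n0"]) auto
qed


end

section \<open>Degree bounds and first order expansion of powers\<close>

definition fps_deg_le :: "'a::comm_ring_1 fps \<Rightarrow> nat \<Rightarrow> bool" where
  "fps_deg_le x a \<longleftrightarrow> (\<forall>i>a. fps_nth x i = 0)"

lemma fps_deg_le_mono: "fps_deg_le x a \<Longrightarrow> a \<le> b \<Longrightarrow> fps_deg_le x b"
  by (auto simp: fps_deg_le_def)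

lemma fps_deg_le_add: "fps_deg_le x a \<Longrightarrow> fps_deg_le y a \<Longrightarrow> fps_deg_le (x + y) a"
  by (auto simp: fps_deg_le_def)

lemma fps_deg_le_mult:
  assumes "fps_deg_le x a" "fps_deg_le y b"
  shows "fps_deg_le (x * y) (a + b)"
  unfolding fps_deg_le_def
proof (intro allI impI)
  fix i assume i: "i > a + b"
  have "fps_nth x j * fps_nth y (i - j) = 0" for j
    using assms i unfolding fps_deg_le_def by (cases "j > a") auto
  then show "fps_nth (x * y) i = 0" by (simp add: fps_mult_nth)
qed

lemma fps_deg_le_power: "fps_deg_le x a \<Longrightarrow> fps_deg_le (x ^ k) (k * a)"
proof (induction k)
  case (Suc k)
  then show ?case using fps_deg_le_mult[of x a "x ^ k" "k * a"] by simp
qed (simp add: fps_deg_le_def)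

lemma fps_deg_le_const: "fps_deg_le (fps_const c) 0"
  by (simp add: fps_deg_le_def)

text \<open>Every term of the binomial remainder has at least two factors \<open>h\<close>, and
  since \<open>b \<le> n\<close> exactly two give the largest degree. The case \<open>R = 0\<close>
  covers \<open>m = 1\<close>, where \<open>m - 2\<close> would be truncated.\<close>

lemma power_add_linear_part:
  fixes a h :: "'a::comm_ring_1 fps"
  assumes a: "fps_deg_le a n" and h: "fps_deg_le h b" and b: "b \<le> n" "m \<ge> 1"
  shows "\<exists>R. (a + h) ^ m = a ^ m + of_nat m * a ^ (m - 1) * h + R
    \<and> (R = 0 \<or> m \<ge> 2 \<and> fps_deg_le R ((m - 2) * n + 2 * b))"
  using \<open>m \<ge> 1\<close>
proof (induction m rule: dec_induct)
  case base
  then show ?case by (intro exI[of _ 0]) simp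
next
  case (step m)
  then obtain R where R: "(a + h) ^ m = a ^ m + of_nat m * a ^ (m - 1) * h + R"
    "R = 0 \<or> m \<ge> 2 \<and> fps_deg_le R ((m - 2) * n + 2 * b)" by blast
  obtain k where k: "m = Suc k" using step by (cases m) auto
  \<comment> \<open>New remainder after one more factor \<open>a + h\<close>: the old one times that
    factor, and the product of the linear term with \<open>h\<close>.\<close>
  define S where "S = R * (a + h) + of_nat m * a ^ k * h\<^sup>2"
  have "(a + h) ^ Suc m = (a + h) * (a ^ m + of_nat m * a ^ (m - 1) * h + R)"
    using R(1) by simp
  also have "\<dots> = a ^ Suc m + of_nat (Suc m) * a ^ (Suc m - 1) * h + S"
    by (simp add: S_def k algebra_simps power2_eq_square)
  finally have eq: "(a + h) ^ Suc m = a ^ Suc m + of_nat (Suc m) * a ^ (Suc m - 1) * h + S" .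
  have 1: "fps_deg_le (R * (a + h)) (k * n + 2 * b)"
  proof (cases "R = 0")
    case False
    then obtain l where l: "m = Suc (Suc l)" and "fps_deg_le R (l * n + 2 * b)"
      using R(2) by (auto dest!: le_Suc_ex)
    then have "fps_deg_le (R * (a + h)) ((l * n + 2 * b) + n)"
      by (intro fps_deg_le_mult fps_deg_le_add a fps_deg_le_mono[OF h b(1)])
    then show ?thesis using l k by (simp add: algebra_simps)
  qed (simp add: fps_deg_le_def)
  have "fps_deg_le (fps_const (of_nat m) * a ^ k * h\<^sup>2) (0 + k * n + 2 * b)"
    by (intro fps_deg_le_mult fps_deg_le_const fps_deg_le_power a h)
  then have 2: "fps_deg_le (of_nat m * a ^ k * h\<^sup>2) (k * n + 2 * b)"
    by (simp add: fps_of_nat)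
  have "fps_deg_le S (k * n + 2 * b)" unfolding S_def by (rule fps_deg_le_add[OF 1 2])
  then show ?case using eq k by (intro exI[of _ S]) auto
qed

section \<open>The perturbed vector: its powers and its size\<close>

context frechet_sequence_algebra_shift
begin

text \<open>Since the nonzero positions of \<open>h\<close> near \<open>n\<close> lie in \<open>{n - M..<n - M + L}\<close> with \<open>M = 2 L + 1\<close>,
  products of two factors \<open>h\<close> in \<open>u ^ m\<close> only contribute below degree \<open>m n - M\<close>; above it,
  \<open>u ^ m\<close> depends linearly on the coefficients \<open>b\<close>.\<close>

lemma funpow_shift_power:
  fixes b :: "nat \<Rightarrow> complex"
  assumes M: "M = 2 * L + 1" and f: "fps_deg_le f F" and n: "n > F + M" and m: "m \<ge> 1"
    and h: "h = f + (\<Sum>j<L. fps_const (b j) * unit_seq (n - M + j))"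
    and u: "u = fps_const d * unit_seq n + h"
  shows "(T ^^ (m * n - M)) (u ^ m) = fps_const (d ^ m * v M / v (m * n)) * unit_seq M
      + (\<Sum>j<L. fps_const (of_nat m * d ^ (m - 1) * b j * v j / v (m * n - M + j)) * unit_seq j)"
    and "j < m \<Longrightarrow> (T ^^ (m * n - M)) (u ^ j) = 0"
proof -
  obtain k where k: "m = Suc k" using m by (cases m) auto
  have mn: "m * n - M = k * n + (n - M)" "m * n - M + M = m * n" using n k by auto
  have nth_h: "fps_nth h i = fps_nth f i + (if n - M \<le> i \<and> i < n - M + L then b (i - (n - M)) else 0)" for i
  proof -
    have "(\<Sum>j<L. b j * (if i = n - M + j then 1 else 0))
        = (\<Sum>j<L. if j = i - (n - M) then (if n - M \<le> i then b j else 0) else 0)"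
      by (intro sum.cong) auto
    also have "\<dots> = (if n - M \<le> i \<and> i < n - M + L then b (i - (n - M)) else 0)"
      by (subst sum.delta) auto
    finally show ?thesis by (simp add: h fps_sum_nth)
  qed
  have f0: "fps_nth f i = 0" if "i \<ge> n - M" for i
    using f n that by (auto simp: fps_deg_le_def)
  have deg_h: "fps_deg_le h (n - M + L)"
    unfolding fps_deg_le_def nth_h using f0 by auto
  have deg_a: "fps_deg_le (fps_const d * unit_seq n) n"
    by (auto simp: fps_deg_le_def)
  have deg_u: "fps_deg_le u n"
    unfolding u using n by (intro fps_deg_le_add deg_a fps_deg_le_mono[OF deg_h]) (simp add: M)
  show "(T ^^ (m * n - M)) (u ^ j) = 0" if "j < m"
  proof (rule fps_ext)
    fix i
    \<comment> \<open>As \<open>u\<close> has degree at most \<open>n\<close>, lower powers stay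
      within degree \<open>(m - 1) * n\<close>, which is below \<open>m * n - M\<close> because
      \<open>n > M\<close>.\<close>
    have "j * n \<le> k * n" using that k by (intro mult_right_mono) auto
    then have "i + (m * n - M) > j * n" using mn n by linarith
    then show "fps_nth ((T ^^ (m * n - M)) (u ^ j)) i = fps_nth 0 i"
      using fps_deg_le_power[OF deg_u, of j] by (simp add: nth_funpow_shift fps_deg_le_def)
  qed
  obtain R where R: "u ^ m = (fps_const d * unit_seq n) ^ m
      + of_nat m * (fps_const d * unit_seq n) ^ (m - 1) * h + R"
    "R = 0 \<or> m \<ge> 2 \<and> fps_deg_le R ((m - 2) * n + 2 * (n - M + L))"
    using power_add_linear_part[OF deg_a deg_h _ m] n unfolding u M by auto
  have R0: "fps_nth R i = 0" if "i \<ge> m * n - M" for i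
  proof (cases "R = 0")
    case False
    then obtain l where l: "m = Suc (Suc l)" and "fps_deg_le R (l * n + 2 * (n - M + L))"
      using R(2) by (auto dest!: le_Suc_ex)
    \<comment> \<open>This uses the choice of \<open>M\<close>: with \<open>M = 2 * L + 1\<close>,
      twice \<open>n - M + L\<close> is \<open>2 * n - M - 1\<close>, just below the window.\<close>
    moreover have "l * n + 2 * (n - M + L) < m * n - M"
      using n l by (simp add: M)
    ultimately show ?thesis using that by (simp add: fps_deg_le_def)
  qed simp
  have eq: "u ^ m = fps_const (d ^ m) * fps_X ^ (m * n)
      + fps_const (of_nat m * d ^ k) * (fps_X ^ (k * n) * h) + R"
  proof -
    have "(fps_const d * unit_seq n) ^ j = fps_const (d ^ j) * fps_X ^ (j * n)" for j
      by (simp add: unit_seq_eq power_mult_distrib fps_const_power mult.commute flip: power_mult)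
    moreover have "fps_const (of_nat m * d ^ k) = of_nat m * fps_const (d ^ k)"
      by (simp flip: fps_of_nat)
    moreover have "m - 1 = k" using k by simp
    ultimately show ?thesis by (simp only: R(1) mult.assoc)
  qed
  show "(T ^^ (m * n - M)) (u ^ m) = fps_const (d ^ m * v M / v (m * n)) * unit_seq M
      + (\<Sum>j<L. fps_const (of_nat m * d ^ (m - 1) * b j * v j / v (m * n - M + j)) * unit_seq j)"
  proof (rule fps_ext)
    fix i
    define I where "I = i + (m * n - M)"
    have "I - k * n = n - M + i" "\<not> I < k * n" using mn by (auto simp: I_def)
    then have "fps_nth (u ^ m) I = d ^ m * (if i = M then 1 else 0)
        + of_nat m * d ^ k * (if i < L then b i else 0)"
      using R0[of I] f0[of "n - M + i"] mn
      by (simp add: eq fps_X_power_mult_nth fps_X_power_nth nth_h) (auto simp: I_def)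
    then have lhs: "fps_nth ((T ^^ (m * n - M)) (u ^ m)) i = v i / v I *
        (d ^ m * (if i = M then 1 else 0) + of_nat m * d ^ k * (if i < L then b i else 0))"
      by (simp only: nth_funpow_shift I_def)
    \<comment> \<open>Since \<open>L < M\<close>, the coordinate \<open>M\<close> coming from
      \<open>d ^ m\<close> does not collide with the coordinates below \<open>L\<close>.\<close>
    have "m - 1 = k" "i < L \<Longrightarrow> i \<noteq> M" "i = M \<Longrightarrow> I = m * n" "I = m * n - M + i"
      using mn(2) k M by (auto simp: I_def)
    then show "fps_nth ((T ^^ (m * n - M)) (u ^ m)) i
      = fps_nth (fps_const (d ^ m * v M / v (m * n)) * unit_seq M
      + (\<Sum>j<L. fps_const (of_nat m * d ^ (m - 1) * b j * v j / v (m * n - M + j)) * unit_seq j)) i"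
      unfolding lhs fps_add_nth nth_sum_unit_seq by (cases "i < L"; cases "i = M") auto
  qed
qed

text \<open>Iterates part (ii) of Property B. The seminorm \<open>s\<close> dominates both the one
  from the induction hypothesis and \<open>p r\<close>, since (ii) has the same seminorm in both
  factors.\<close>

lemma unit_seq_power_bound:
  assumes B: "property_B X p" and r: "r \<ge> 1" and m: "m \<ge> 1"
  shows "\<exists>q\<ge>1. \<exists>C>0. \<forall>n. p r (unit_seq n) ^ m \<le> C * p q (unit_seq (m * n))"
  using m
proof (induction m rule: dec_induct)
  case base
  then show ?case using r by (intro exI[of _ r] conjI exI[of _ 1]) auto
next
  case (step m)
  then obtain q C where q: "q \<ge> 1" "C > 0"
    "\<And>n. p r (unit_seq n) ^ m \<le> C * p q (unit_seq (m * n))" by blast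
  define s where "s = max q r"
  have s: "s \<ge> 1" using q by (simp add: s_def)
  obtain q' C' where q': "q' \<ge> 1" "C' > 0"
    "\<And>n k. p s (unit_seq n) * p s (unit_seq k) \<le> C' * p q' (unit_seq (n + k))"
    using B s unfolding property_B_def by meson
  have "p r (unit_seq n) ^ Suc m \<le> (C * C') * p q' (unit_seq (Suc m * n))" for n
  proof -
    have "p r (unit_seq n) ^ Suc m = p r (unit_seq n) ^ m * p r (unit_seq n)" by simp
    also have "\<dots> \<le> (C * p s (unit_seq (m * n))) * p s (unit_seq n)"
    proof (rule mult_mono)
      have "p q (unit_seq (m * n)) \<le> p s (unit_seq (m * n))"
        using q(1) by (intro seminorm_mono) (auto simp: s_def)
      then show "p r (unit_seq n) ^ m \<le> C * p s (unit_seq (m * n))"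
        using q(3)[of n] q(2) by (meson mult_left_mono order_less_imp_le order_trans)
      show "p r (unit_seq n) \<le> p s (unit_seq n)"
        using r by (intro seminorm_mono) (auto simp: s_def)
    qed (use q(2) s r in \<open>auto intro!: seminorm_nonneg mult_nonneg_nonneg\<close>)
    also have "\<dots> \<le> C * (C' * p q' (unit_seq (m * n + n)))"
      unfolding mult.assoc using q'(3) q(2) by (intro mult_left_mono) auto
    finally show ?thesis by (simp add: add.commute mult.assoc)
  qed
  then show ?case using q' q by (intro exI[of _ q'] conjI exI[of _ "C * C'"]) auto
qed

text \<open>Part (iii) of Property B with \<open>root\<close> in place of \<open>powr\<close>,
  extended to \<open>m = 1\<close>, where \<open>\<rho> = r\<close> and \<open>\<tau> = t\<close>
  give equality with \<open>C = 1\<close>.\<close>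

lemma property_B_root:
  assumes B: "property_B X p" and m: "m \<ge> 1" and M: "M \<ge> 1" and r: "r \<ge> 1"
  obtains \<rho> where "\<rho> \<ge> 1" "\<And>t. t \<ge> 1 \<Longrightarrow> \<exists>\<tau>\<ge>1. \<exists>C>0. \<forall>k\<le>M. \<forall>n\<ge>M.
    p t (unit_seq (m * n)) * p r (unit_seq (n - k))
      \<le> C * root m (p \<tau> (unit_seq (m * n))) * p \<rho> (unit_seq (m * n - k))"
proof (cases "m = 1")
  case True
  then show thesis
    using r by (intro that[of r]) (auto intro!: exI[of _ "1::real"])
next
  case False
  then have "m \<ge> 2" using m by simp
  then have "\<exists>\<rho>\<ge>1. \<forall>t\<ge>1. \<exists>\<tau>\<ge>1. \<exists>C>0. \<forall>k\<le>M. \<forall>n\<ge>M.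
    p t (unit_seq (m * n)) * p r (unit_seq (n - k))
      \<le> C * p \<tau> (unit_seq (m * n)) powr (1 / real m) * p \<rho> (unit_seq (m * n - k))"
    using B[unfolded property_B_def, THEN conjunct2, THEN conjunct2, THEN conjunct2] M r by simp
  then obtain \<rho> where \<rho>: "\<rho> \<ge> 1" "\<And>t. t \<ge> 1 \<Longrightarrow> \<exists>\<tau>\<ge>1. \<exists>C>0. \<forall>k\<le>M. \<forall>n\<ge>M.
    p t (unit_seq (m * n)) * p r (unit_seq (n - k))
      \<le> C * p \<tau> (unit_seq (m * n)) powr (1 / real m) * p \<rho> (unit_seq (m * n - k))"
    by blast
  have "root m (p \<tau> (unit_seq n)) = p \<tau> (unit_seq n) powr (1 / real m)" if "\<tau> \<ge> 1" for \<tau> n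
    using m seminorm_nonneg[OF that unit_seq_mem] by (intro root_powr_inverse) auto
  note root = this
  show thesis
  proof (rule that[OF \<rho>(1)])
    fix t :: nat assume "t \<ge> 1"
    then obtain \<tau> C where "\<tau> \<ge> 1" "C > 0" "\<forall>k\<le>M. \<forall>n\<ge>M.
      p t (unit_seq (m * n)) * p r (unit_seq (n - k))
        \<le> C * p \<tau> (unit_seq (m * n)) powr (1 / real m) * p \<rho> (unit_seq (m * n - k))"
      using \<rho>(2) by blast
    then show "\<exists>\<tau>\<ge>1. \<exists>C>0. \<forall>k\<le>M. \<forall>n\<ge>M.
      p t (unit_seq (m * n)) * p r (unit_seq (n - k))
        \<le> C * root m (p \<tau> (unit_seq (m * n))) * p \<rho> (unit_seq (m * n - k))"
      unfolding root[symmetric] by (intro exI[of _ \<tau>] conjI exI[of _ C]) (simp_all add: root)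
  qed
qed

text \<open>The lower order coefficients \<open>b\<close> are of size \<open>\<bar>d n\<bar> \<bar>v (m n - k) / v (m n)\<bar>\<close>. Property B
  moves \<open>unit_seq (n - k)\<close> to \<open>unit_seq (m n - k)\<close>, and continuity of \<open>T\<close> then controls
  \<open>v (m n - k) unit_seq (m n - k)\<close> by \<open>v (m n) unit_seq (m n)\<close>.\<close>

lemma perturbation_tendsto_zero:
  fixes y :: "nat \<Rightarrow> complex" and d :: "nat \<Rightarrow> complex" and \<eta> :: real
  assumes B: "property_B X p" and m: "m \<ge> 1" and q: "q \<ge> 1" and \<eta>: "\<eta> > 0"
    and L: "L \<le> M" "M \<ge> 1"
    and d: "\<And>n. d n ^ m = of_real \<eta> * v (m * n) / v M"
    and b: "\<And>n j. b n j = y j * v (m * n - M + j) / (v j * of_nat m * d n ^ (m - 1))"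
  shows "(\<lambda>n. p q (fps_const (d n) * unit_seq n + (\<Sum>j<L. fps_const (b n j) * unit_seq (n - M + j))))
    \<longlonglongrightarrow> 0"
proof -
  \<comment> \<open>The seminorm of \<open>v n\<close> times \<open>unit_seq n\<close>, which tends
    to \<open>0\<close> by mixing.\<close>
  define A where "A r n = norm (v n) * p r (unit_seq n)" for r n
  have A0: "A r n \<ge> 0" if "r \<ge> 1" for r n
    using seminorm_nonneg[OF that unit_seq_mem] by (simp add: A_def)
  have pe0: "p r (unit_seq n) \<ge> 0" if "r \<ge> 1" for r n
    using seminorm_nonneg[OF that unit_seq_mem] .
  have "strict_mono (\<lambda>n. m * n)" using m by (auto simp: strict_mono_def)
  then have A: "(\<lambda>n. A r (m * n)) \<longlonglongrightarrow> 0" if "r \<ge> 1" for r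
    using LIMSEQ_subseq_LIMSEQ[OF mixing_imp_tendsto_zero[OF that]] by (simp add: o_def A_def)
  have root_lim: "(\<lambda>n. root m (c * A r (m * n))) \<longlonglongrightarrow> 0" if "r \<ge> 1" for c r
  proof -
    have "(\<lambda>n. root m (c * A r (m * n))) \<longlonglongrightarrow> root m (c * 0)"
      by (intro tendsto_real_root tendsto_mult tendsto_const A that)
    then show ?thesis by simp
  qed
  define \<kappa> where "\<kappa> = \<eta> / norm (v M)"
  have \<kappa>: "\<kappa> > 0" using \<eta> by (simp add: \<kappa>_def)
  have norm_d: "norm (d n) ^ m = \<kappa> * norm (v (m * n))" for n
    using \<eta> by (simp add: \<kappa>_def norm_mult norm_divide d flip: norm_power)
  have d_nz: "norm (d n) > 0" for n
    using norm_d[of n] \<kappa> m by (cases "d n = 0") (auto simp: zero_power)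
  have root_d: "norm (d n) = root m (\<kappa> * norm (v (m * n)))" for n
    using real_root_power_cancel[of m "norm (d n)"] m by (simp flip: norm_d)
  have lim_d: "(\<lambda>n. norm (d n) * p q (unit_seq n)) \<longlonglongrightarrow> 0"
  proof -
    obtain s C where s: "s \<ge> 1" "C > 0" "\<And>n. p q (unit_seq n) ^ m \<le> C * p s (unit_seq (m * n))"
      using unit_seq_power_bound[OF B q m] by blast
    \<comment> \<open>After taking \<open>m\<close>-th powers, \<open>norm (d n) ^ m\<close>
      supplies \<open>v (m * n)\<close> and part (ii) supplies \<open>unit_seq (m * n)\<close>, the
      two factors of \<open>A s (m * n)\<close>.\<close>
    have "norm (d n) * p q (unit_seq n) \<le> root m ((\<kappa> * C) * A s (m * n))" for n
    proof -
      have "norm (d n) * p q (unit_seq n) = root m (norm (d n) ^ m * p q (unit_seq n) ^ m)"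
        using m pe0[OF q] by (simp add: real_root_mult real_root_power_cancel)
      also have "\<dots> \<le> root m (norm (d n) ^ m * (C * p s (unit_seq (m * n))))"
        using m s(3)[of n] by (intro real_root_le_mono mult_left_mono) auto
      also have "norm (d n) ^ m * (C * p s (unit_seq (m * n))) = (\<kappa> * C) * A s (m * n)"
        by (simp add: norm_d A_def)
      finally show ?thesis .
    qed
    then show ?thesis
      by (rule tendsto_zero_squeeze[OF root_lim[OF s(1)]]) (simp add: pe0[OF q])
  qed
  \<comment> \<open>The order of quantifiers in (iii) is essential: \<open>\<rho>\<close> comes
    first, continuity of the iterates into \<open>p \<rho>\<close> determines \<open>t1\<close>, and
    only then is \<open>t\<close> chosen and \<open>\<tau>\<close> obtained.\<close>
  obtain \<rho> where \<rho>: "\<rho> \<ge> 1" "\<And>t. t \<ge> 1 \<Longrightarrow> \<exists>\<tau>\<ge>1. \<exists>C>0. \<forall>k\<le>M. \<forall>n\<ge>M.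
    p t (unit_seq (m * n)) * p q (unit_seq (n - k))
      \<le> C * root m (p \<tau> (unit_seq (m * n))) * p \<rho> (unit_seq (m * n - k))"
    using property_B_root[OF B m L(2) q] by blast
  obtain t1 C1 where t1: "t1 \<ge> 1" "C1 > 0"
    "\<And>N x. N \<le> M \<Longrightarrow> x \<in> X \<Longrightarrow> p \<rho> ((T ^^ N) x) \<le> C1 * p t1 x"
    using funpow_shift_equicontinuous[OF \<rho>(1), of M] by blast
  \<comment> \<open>Part (i) makes \<open>p t\<close> positive on all unit sequences, so that the
    factor \<open>p t (unit_seq (m * n))\<close> can be cancelled below.\<close>
  obtain t0 where t0: "t0 \<ge> 1" "\<And>n. p t0 (unit_seq n) > 0"
    using B unfolding property_B_def by blast
  define t where "t = max t0 t1"
  have t: "t \<ge> 1" using t0 by (simp add: t_def)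
  have pos: "p t (unit_seq n) > 0" for n
    using t0(2)[of n] seminorm_mono[OF t0(1) _ unit_seq_mem, of t n] by (simp add: t_def)
  have shift_bound: "A \<rho> (n - k) \<le> C1 * A t n" if "k \<le> M" "k \<le> n" for n k
  proof -
    have "(T ^^ k) (fps_const (v n) * unit_seq n) = fps_const (v (n - k)) * unit_seq (n - k)"
      by (rule fps_ext) (use that in \<open>auto simp: nth_funpow_shift\<close>)
    then have "A \<rho> (n - k) \<le> C1 * A t1 n"
      using t1(3)[OF that(1), of "fps_const (v n) * unit_seq n"] \<rho>(1) t1(1)
      by (simp add: A_def seminorm_scale)
    also have "\<dots> \<le> C1 * A t n"
      unfolding A_def using t1 by (intro mult_left_mono seminorm_mono) (auto simp: t_def)
    finally show ?thesis .
  qed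
  obtain \<tau> C2 where \<tau>: "\<tau> \<ge> 1" "C2 > 0" and C2: "\<And>k n. k \<le> M \<Longrightarrow> n \<ge> M \<Longrightarrow>
    p t (unit_seq (m * n)) * p q (unit_seq (n - k))
      \<le> C2 * root m (p \<tau> (unit_seq (m * n))) * p \<rho> (unit_seq (m * n - k))"
    using \<rho>(2)[OF t] by blast
  have lim_b: "(\<lambda>n. norm (b n j) * p q (unit_seq (n - M + j))) \<longlonglongrightarrow> 0" if "j < L" for j
  proof -
    define D where "D = norm (y j) / (norm (v j) * real m) * (C2 * C1 / \<kappa>)"
    have "norm (b n j) * p q (unit_seq (n - M + j)) \<le> D * root m (\<kappa> * A \<tau> (m * n))"
      if n: "n \<ge> M" for n
    proof -
      \<comment> \<open>Turns the positions \<open>n - M + j\<close> and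
        \<open>m * n - M + j\<close> into the form \<open>n - k\<close> and \<open>m * n - k\<close>
        of part (iii).\<close>
      define k where "k = M - j"
      have "n \<le> m * n" using m by simp
      then have k: "k \<le> M" "k \<le> m * n" "n - M + j = n - k" "m * n - M + j = m * n - k"
        unfolding k_def using \<open>j < L\<close> L n by linarith+
      have rt0: "root m (p \<tau> (unit_seq (m * n))) \<ge> 0" using pe0[OF \<tau>(1)] m by simp
      have "p t (unit_seq (m * n)) * (norm (v (m * n - k)) * p q (unit_seq (n - k)))
          = norm (v (m * n - k)) * (p t (unit_seq (m * n)) * p q (unit_seq (n - k)))" by simp
      also have "\<dots> \<le> norm (v (m * n - k))
          * (C2 * root m (p \<tau> (unit_seq (m * n))) * p \<rho> (unit_seq (m * n - k)))"
        by (intro mult_left_mono C2[OF k(1) n]) auto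
      also have "\<dots> = C2 * root m (p \<tau> (unit_seq (m * n))) * A \<rho> (m * n - k)"
        by (simp add: A_def)
      also have "\<dots> \<le> C2 * root m (p \<tau> (unit_seq (m * n))) * (C1 * A t (m * n))"
        using \<tau>(2) rt0 by (intro mult_left_mono shift_bound[OF k(1,2)]) auto
      also have "\<dots> = p t (unit_seq (m * n))
          * (C2 * C1 * root m (p \<tau> (unit_seq (m * n))) * norm (v (m * n)))"
        by (simp add: A_def)
      finally have le: "norm (v (m * n - k)) * p q (unit_seq (n - k))
          \<le> C2 * C1 * root m (p \<tau> (unit_seq (m * n))) * norm (v (m * n))"
        using pos by simp
      \<comment> \<open>Dividing by \<open>norm (d n) ^ (m - 1)\<close> leaves a single factor
        \<open>norm (d n)\<close>, itself an \<open>m\<close>-th root of a multiple of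
        \<open>norm (v (m * n))\<close>; it merges with the root from (iii).\<close>
      have "norm (v (m * n)) = norm (d n) * norm (d n) ^ (m - 1) / \<kappa>"
        using norm_d[of n] \<kappa> m by (cases m) (auto simp: field_simps)
      then have vd: "norm (v (m * n)) / norm (d n) ^ (m - 1) = norm (d n) / \<kappa>"
        using d_nz[of n] by simp
      have "norm (b n j) * p q (unit_seq (n - M + j))
          = norm (y j) / (norm (v j) * real m)
            * ((norm (v (m * n - k)) * p q (unit_seq (n - k))) / norm (d n) ^ (m - 1))"
        by (simp add: b k norm_mult norm_divide norm_power)
      also have "\<dots> \<le> norm (y j) / (norm (v j) * real m)
          * ((C2 * C1 * root m (p \<tau> (unit_seq (m * n))) * norm (v (m * n))) / norm (d n) ^ (m - 1))"
        by (intro mult_left_mono divide_right_mono le) auto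
      also have "\<dots> = norm (y j) / (norm (v j) * real m)
          * (C2 * C1 * root m (p \<tau> (unit_seq (m * n))) * (norm (v (m * n)) / norm (d n) ^ (m - 1)))"
        by simp
      also have "\<dots> = D * (norm (d n) * root m (p \<tau> (unit_seq (m * n))))"
        unfolding vd by (simp add: D_def)
      also have "norm (d n) * root m (p \<tau> (unit_seq (m * n))) = root m (\<kappa> * A \<tau> (m * n))"
        by (simp add: root_d real_root_mult A_def)
      finally show ?thesis .
    qed
    then show ?thesis
      by (rule tendsto_zero_squeeze[OF tendsto_mult_right_zero[OF root_lim[OF \<tau>(1)]]])
        (simp_all add: pe0[OF q])
  qed
  have lim: "(\<lambda>n. norm (d n) * p q (unit_seq n)
      + (\<Sum>j<L. norm (b n j) * p q (unit_seq (n - M + j)))) \<longlonglongrightarrow> 0"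
    by (rule tendsto_add_zero[OF lim_d tendsto_null_sum[OF lim_b]]) simp
  have "p q (fps_const (d n) * unit_seq n + (\<Sum>j<L. fps_const (b n j) * unit_seq (n - M + j)))
      \<le> norm (d n) * p q (unit_seq n) + (\<Sum>j<L. norm (b n j) * p q (unit_seq (n - M + j)))" for n
  proof -
    have "p q (fps_const (d n) * unit_seq n + (\<Sum>j<L. fps_const (b n j) * unit_seq (n - M + j)))
      \<le> p q (fps_const (d n) * unit_seq n) + p q (\<Sum>j<L. fps_const (b n j) * unit_seq (n - M + j))"
      by (intro seminorm_triangle[OF q]) auto
    also have "p q (\<Sum>j<L. fps_const (b n j) * unit_seq (n - M + j))
      \<le> (\<Sum>j<L. p q (fps_const (b n j) * unit_seq (n - M + j)))"
      by (intro seminorm_sum[OF q]) auto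
    finally show ?thesis by (simp add: seminorm_scale[OF q])
  qed
  then show ?thesis
    by (rule tendsto_zero_squeeze[OF lim]) (simp add: seminorm_nonneg[OF q])
qed

section \<open>Approximation and a generic vector\<close>

text \<open>As \<open>funpow_shift_power\<close> is exact, the only error at the target is the term
  in \<open>unit_seq M\<close>, whose size \<open>\<eta>\<close> is fixed before
  \<open>n\<close>.\<close>

lemma approximation:
  fixes y :: "nat \<Rightarrow> complex"
  assumes B: "property_B X p" and x: "x \<in> X" and q: "q \<ge> 1" and \<epsilon>: "\<epsilon> > 0"
    and r: "r \<ge> 1" and \<delta>: "\<delta> > 0" and m: "m \<ge> 1"
  obtains u N where "u \<in> X" "p q (u - x) < \<epsilon>"
    "p r ((T ^^ N) (u ^ m) - (\<Sum>j<L. fps_const (y j) * unit_seq j)) < \<delta>"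
    "\<And>j. j < m \<Longrightarrow> (T ^^ N) (u ^ j) = 0"
proof -
  define M where "M = 2 * L + 1"
  \<comment> \<open>Makes \<open>\<eta> * p r (unit_seq M) < \<delta>\<close>; the summand
    \<open>1\<close> covers a vanishing seminorm.\<close>
  define \<eta> where "\<eta> = \<delta> / (p r (unit_seq M) + 1)"
  have prM: "p r (unit_seq M) \<ge> 0" by (rule seminorm_nonneg[OF r unit_seq_mem])
  have \<eta>: "\<eta> > 0" using \<delta> prM by (simp add: \<eta>_def)
  have "\<exists>d. d ^ m = of_real \<eta> * v (m * n) / v M" for n
  proof -
    let ?z = "of_real \<eta> * v (m * n) / v M"
    have "exp (Ln ?z / of_nat m) ^ m = exp (Ln ?z)"
      using m by (simp flip: exp_of_nat_mult)
    also have "\<dots> = ?z" using \<eta> by (intro exp_Ln) simp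
    finally show ?thesis by blast
  qed
  then obtain d where d: "\<And>n. d n ^ m = of_real \<eta> * v (m * n) / v M" by metis
  \<comment> \<open>Solves for the coefficients \<open>b n j\<close> so that coordinate
    \<open>j < L\<close> of the shifted power equals \<open>y j\<close>.\<close>
  define b where "b n j = y j * v (m * n - M + j) / (v j * of_nat m * d n ^ (m - 1))" for n j
  define g where
    "g n = fps_const (d n) * unit_seq n + (\<Sum>j<L. fps_const (b n j) * unit_seq (n - M + j))" for n
  have g: "(\<lambda>n. p q (g n)) \<longlonglongrightarrow> 0"
    unfolding g_def by (rule perturbation_tendsto_zero[OF B m q \<eta> _ _ d b_def]) (auto simp: M_def)
  have "\<forall>\<^sub>F N in sequentially. p q (partial_sum N x - x) < \<epsilon> / 2"
    using partial_sum_tendsto[OF x q] \<epsilon> by (intro order_tendstoD(2)[of _ 0]) auto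
  then obtain F where F: "p q (partial_sum F x - x) < \<epsilon> / 2"
    by (auto simp: eventually_sequentially)
  define f where "f = partial_sum F x"
  have deg_f: "fps_deg_le f F" by (simp add: f_def fps_deg_le_def nth_partial_sum)
  have "\<forall>\<^sub>F n in sequentially. p q (g n) < \<epsilon> / 2"
    using g \<epsilon> by (intro order_tendstoD(2)[of _ 0]) auto
  then have "\<forall>\<^sub>F n in sequentially. p q (g n) < \<epsilon> / 2 \<and> n > F + M"
    using eventually_gt_at_top[of "F + M"] by eventually_elim auto
  then obtain n where n: "p q (g n) < \<epsilon> / 2" "n > F + M"
    by (auto simp: eventually_sequentially)
  define h where "h = f + (\<Sum>j<L. fps_const (b n j) * unit_seq (n - M + j))"
  define u where "u = fps_const (d n) * unit_seq n + h"
  note power = funpow_shift_power[OF M_def deg_f n(2) m h_def u_def]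
  have "d n ^ m \<noteq> 0" using d[of n] \<eta> by simp
  then have dn: "d n ^ (m - 1) \<noteq> 0" using m by (cases m) auto
  have 1: "(\<Sum>j<L. fps_const (of_nat m * d n ^ (m - 1) * b n j * v j / v (m * n - M + j)) * unit_seq j)
      = (\<Sum>j<L. fps_const (y j) * unit_seq j)"
  proof (rule sum.cong)
    fix j
    have "of_nat m * d n ^ (m - 1) * b n j * v j / v (m * n - M + j) = y j"
      using dn m by (simp add: b_def)
    then show "fps_const (of_nat m * d n ^ (m - 1) * b n j * v j / v (m * n - M + j)) * unit_seq j
      = fps_const (y j) * unit_seq j" by simp
  qed simp
  have 2: "d n ^ m * v M / v (m * n) = of_real \<eta>" by (simp add: d)
  show thesis
  proof (rule that)
    show "u \<in> X" by (simp add: u_def h_def f_def)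
    have gX: "g n \<in> X" by (simp add: g_def)
    have "u - x = (f - x) + g n" by (simp add: u_def h_def g_def)
    then have "p q (u - x) \<le> p q (f - x) + p q (g n)"
      using seminorm_triangle[OF q, of "f - x" "g n"] x gX by (simp only:) (simp add: f_def)
    then show "p q (u - x) < \<epsilon>" using F n(1) unfolding f_def by linarith
    have "(T ^^ (m * n - M)) (u ^ m) - (\<Sum>j<L. fps_const (y j) * unit_seq j)
        = fps_const (of_real \<eta>) * unit_seq M"
      using power(1) unfolding 1 2 by simp
    moreover have "\<eta> * p r (unit_seq M) < \<delta>"
      using prM \<delta> by (simp add: \<eta>_def field_simps)
    ultimately show "p r ((T ^^ (m * n - M)) (u ^ m) - (\<Sum>j<L. fps_const (y j) * unit_seq j)) < \<delta>"
      using \<eta> by (simp add: seminorm_scale[OF r])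
  qed (rule power(2))
qed

text \<open>Baire for countably many conditions: \<open>approximation\<close> finds a vector
  \<open>u\<close> in any ball, and continuity of one iterate and of finitely many powers extends
  the condition to a ball around \<open>u\<close>.\<close>

lemma generic_vector:
  fixes y :: "'i::countable \<Rightarrow> nat \<Rightarrow> complex" and L :: "'i \<Rightarrow> nat"
  assumes B: "property_B X p"
  obtains x where "x \<in> X"
    "\<And>m r \<delta> i. m \<ge> 1 \<Longrightarrow> r \<ge> 1 \<Longrightarrow> \<delta> > 0 \<Longrightarrow>
      \<exists>N. p r ((T ^^ N) (x ^ m) - (\<Sum>j<L i. fps_const (y i j) * unit_seq j)) < \<delta> \<and>
        (\<forall>j\<in>{1..<m}. p r ((T ^^ N) (x ^ j)) < \<delta>)"
proof -
  define target where "target i = (\<Sum>j<L i. fps_const (y i j) * unit_seq j)" for i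
  have target_mem: "target i \<in> X" for i by (simp add: target_def)
  \<comment> \<open>The successors let every quadruple from the countable index type encode an
    admissible exponent, seminorm and tolerance.\<close>
  define H where "H = (\<lambda>(m, r, k, i) x.
    \<exists>N. p (Suc r) ((T ^^ N) (x ^ Suc m) - target i) < inverse (real (Suc k)) \<and>
      (\<forall>j\<in>{1..<Suc m}. p (Suc r) ((T ^^ N) (x ^ j)) < inverse (real (Suc k))))"
  have "\<exists>x\<in>X. \<forall>n. H (from_nat n) x"
  proof (rule Baire_category)
    fix n q :: nat and x and \<epsilon> :: real assume x: "x \<in> X" and q: "q \<ge> 1" and \<epsilon>: "\<epsilon> > 0"
    obtain m r' k i where n: "(from_nat n :: nat \<times> nat \<times> nat \<times> 'i) = (m, r', k, i)"
      by (cases "from_nat n :: nat \<times> nat \<times> nat \<times> 'i") blast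
    define r where "r = Suc r'"
    define \<delta> where "\<delta> = inverse (real (Suc k))"
    have r: "r \<ge> 1" and \<delta>: "\<delta> > 0" by (simp_all add: r_def \<delta>_def)
    have \<delta>2: "\<delta> / 2 > 0" and m1: "Suc m \<ge> 1" using \<delta> by simp_all
    obtain u N where u: "u \<in> X" "p q (u - x) < \<epsilon>"
      "p r ((T ^^ N) (u ^ Suc m) - target i) < \<delta> / 2"
      "\<And>j. j < Suc m \<Longrightarrow> (T ^^ N) (u ^ j) = 0"
      using approximation[OF B x q \<epsilon> r \<delta>2 m1, where L = "L i" and y = "y i"]
      unfolding target_def by blast
    obtain q' C where q': "q' \<ge> 1" "C > 0" "\<And>x. x \<in> X \<Longrightarrow> p r ((T ^^ N) x) \<le> C * p q' x"
      using funpow_shift_continuous[OF r, of N] by blast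
    \<comment> \<open>Bounds \<open>p q'\<close> on the ball of radius
      \<open>\<epsilon>' \<le> 1\<close> around \<open>u\<close>; \<open>R \<ge> 1\<close> lets
      \<open>R ^ m\<close> dominate the lower powers of \<open>R\<close>.\<close>
    define R where "R = p q' u + 1"
    have R: "R \<ge> 1" using seminorm_nonneg[OF q'(1) u(1)] by (simp add: R_def)
    define K where "K = C * (real (Suc m) * R ^ m)"
    have K: "K > 0" using q'(2) R by (simp add: K_def)
    define \<epsilon>' where "\<epsilon>' = min 1 (\<delta> / (2 * K))"
    have \<epsilon>': "\<epsilon>' > 0" using \<delta> K by (simp add: \<epsilon>'_def)
    have close: "p r ((T ^^ N) (z ^ Suc j) - (T ^^ N) (u ^ Suc j)) \<le> \<delta> / 2"
      if z: "z \<in> X" "p q' (z - u) \<le> \<epsilon>'" and j: "j \<le> m" for z j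
    proof -
      note mem = power_Suc_mem[OF z(1), of j] power_Suc_mem[OF u(1), of j]
      have d0: "p q' (z - u) \<ge> 0" by (rule seminorm_nonneg[OF q'(1) diff_mem[OF z(1) u(1)]])
      have pz: "p q' z \<le> R"
        using seminorm_triangle[OF q'(1) diff_mem[OF z(1) u(1)] u(1)] z(2)
        by (simp add: R_def \<epsilon>'_def)
      have pu: "p q' u \<le> R" by (simp add: R_def)
      have "p r ((T ^^ N) (z ^ Suc j) - (T ^^ N) (u ^ Suc j)) \<le> C * p q' (z ^ Suc j - u ^ Suc j)"
        unfolding funpow_shift_diff[symmetric] by (rule q'(3)[OF diff_mem[OF mem]])
      also have "\<dots> \<le> C * (real (Suc j) * R ^ j * p q' (z - u))"
        using q'(2) by (intro mult_left_mono seminorm_power_diff[OF q'(1) z(1) u(1) pz pu]) simp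
      also have "\<dots> \<le> C * (real (Suc m) * R ^ m * \<epsilon>')"
        using q'(2) R j z(2) d0 \<epsilon>' by (intro mult_left_mono mult_mono power_increasing) auto
      also have "\<dots> = K * \<epsilon>'" by (simp add: K_def)
      also have "\<dots> \<le> K * (\<delta> / (2 * K))" using K by (intro mult_left_mono) (auto simp: \<epsilon>'_def)
      also have "\<dots> = \<delta> / 2" using K by simp
      finally show ?thesis .
    qed
    have "H (from_nat n) z" if z: "z \<in> X" "p q' (z - u) \<le> \<epsilon>'" for z
    proof -
      note mem = power_Suc_mem[OF z(1), of m] power_Suc_mem[OF u(1), of m]
      have 1: "p r ((T ^^ N) (z ^ Suc m) - target i) < \<delta>"
        using seminorm_triangle3[OF r funpow_shift_mem[OF mem(1), of N]
            funpow_shift_mem[OF mem(2), of N] target_mem[of i]] close[OF z order_refl] u(3) by linarith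
      have 2: "p r ((T ^^ N) (z ^ j)) < \<delta>" if j: "j \<in> {1..<Suc m}" for j
      proof -
        obtain l where l: "j = Suc l" using j by (cases j) auto
        then show ?thesis using close[OF z, of l] u(4)[of j] j \<delta> by simp
      qed
      show ?thesis
        unfolding n H_def prod.case r_def[symmetric] \<delta>_def[symmetric] using 1 2 by blast
    qed
    then show "\<exists>y\<in>X. \<exists>q'\<ge>1. \<exists>\<epsilon>'>0. p q (y - x) < \<epsilon> \<and>
        (\<forall>z\<in>X. p q' (z - y) \<le> \<epsilon>' \<longrightarrow> H (from_nat n) z)"
      using u(1,2) q'(1) \<epsilon>' by blast
  qed
  then obtain x where x: "x \<in> X" "\<And>n. H (from_nat n) x" by blast
  show thesis
  proof (rule that[OF x(1), folded target_def])
    fix m r :: nat and \<delta> :: real and i assume mr: "m \<ge> 1" "r \<ge> 1" and "\<delta> > 0"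
    then obtain k where k: "inverse (real (Suc k)) < \<delta>" using reals_Archimedean by blast
    have "H (m - 1, r - 1, k, i) x"
      using x(2)[of "to_nat (m - 1, r - 1, k, i)"] by simp
    then obtain N where "p r ((T ^^ N) (x ^ m) - target i) < inverse (real (Suc k))"
      "\<forall>j\<in>{1..<m}. p r ((T ^^ N) (x ^ j)) < inverse (real (Suc k))"
      unfolding H_def prod.case using mr by auto
    then show "\<exists>N. p r ((T ^^ N) (x ^ m) - target i) < \<delta> \<and>
        (\<forall>j\<in>{1..<m}. p r ((T ^^ N) (x ^ j)) < \<delta>)"
      using k by (meson order.strict_trans)
  qed
qed

section \<open>Dense targets and hypercyclicity of polynomials in the generic vector\<close>

text \<open>A list selects coefficients from a countable dense subset of the complex numbers. Lists
  of naturals form a countable type, as \<open>generic_vector\<close> requires of its index.\<close>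

lemma countable_dense_targets:
  obtains e :: "nat \<Rightarrow> complex" where
    "\<And>z q \<epsilon>. z \<in> X \<Longrightarrow> q \<ge> 1 \<Longrightarrow> \<epsilon> > 0 \<Longrightarrow>
      \<exists>l :: nat list. p q ((\<Sum>j<length l. fps_const (e (l ! j)) * unit_seq j) - z) < \<epsilon>"
proof -
  obtain D :: "complex set" where D: "countable D" "\<And>U. open U \<Longrightarrow> U \<noteq> {} \<Longrightarrow> \<exists>d\<in>D. d \<in> U"
    using countable_dense_exists by blast
  have "D \<noteq> {}" using D(2)[of UNIV] by auto
  define e where "e = from_nat_into D"
  have e: "\<exists>k. norm (e k - a) < \<epsilon>" if "\<epsilon> > 0" for a \<epsilon>
  proof -
    obtain d where d: "d \<in> D" "d \<in> ball a \<epsilon>"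
      using D(2)[of "ball a \<epsilon>"] \<open>\<epsilon> > 0\<close> centre_in_ball by blast
    have "range e = D" unfolding e_def by (rule range_from_nat_into[OF \<open>D \<noteq> {}\<close> D(1)])
    then obtain k where "d = e k" using d(1) by blast
    then show ?thesis using d(2) by (auto simp: dist_norm norm_minus_commute)
  qed
  show thesis
  proof (rule that)
    fix z and q :: nat and \<epsilon> :: real assume z: "z \<in> X" and q: "q \<ge> 1" and \<epsilon>: "\<epsilon> > 0"
    have "\<forall>\<^sub>F N in sequentially. p q (partial_sum N z - z) < \<epsilon> / 2"
      using partial_sum_tendsto[OF z q] \<epsilon> by (intro order_tendstoD(2)[of _ 0]) auto
    then obtain N where N: "p q (partial_sum N z - z) < \<epsilon> / 2"
      by (auto simp: eventually_sequentially)
    \<comment> \<open>Each of the \<open>N\<close> coefficients contributes at most an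
      \<open>N + 1\<close>-st part of \<open>\<epsilon> / 2\<close>; the added ones avoid division
      by \<open>0\<close>.\<close>
    define c where "c j = \<epsilon> / (2 * (real N + 1) * (p q (unit_seq j) + 1))" for j
    have pe: "p q (unit_seq j) \<ge> 0" for j by (rule seminorm_nonneg[OF q unit_seq_mem])
    have c: "c j > 0" for j using \<epsilon> pe[of j] by (simp add: c_def)
    have "\<exists>k. norm (e k - fps_nth z j) < c j" for j by (rule e[OF c])
    then obtain k where k: "\<And>j. norm (e (k j) - fps_nth z j) < c j"
      by metis
    define l where "l = map k [0..<N]"
    define s where "s = (\<Sum>j<length l. fps_const (e (l ! j)) * unit_seq j)"
    have s: "s = (\<Sum>j<N. fps_const (e (k j)) * unit_seq j)"
      unfolding s_def by (intro sum.cong) (auto simp: l_def)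
    have "s - partial_sum N z = (\<Sum>j<N. fps_const (e (k j) - fps_nth z j) * unit_seq j)"
      by (rule fps_ext) (simp add: s nth_sum_unit_seq nth_partial_sum)
    then have "p q (s - partial_sum N z)
        \<le> (\<Sum>j<N. p q (fps_const (e (k j) - fps_nth z j) * unit_seq j))"
      by (simp add: seminorm_sum[OF q])
    also have "\<dots> \<le> (\<Sum>j<N. \<epsilon> / (2 * (real N + 1)))"
    proof (rule sum_mono)
      fix j
      have "p q (fps_const (e (k j) - fps_nth z j) * unit_seq j)
          = norm (e (k j) - fps_nth z j) * p q (unit_seq j)"
        by (rule seminorm_scale[OF q unit_seq_mem])
      also have "\<dots> \<le> c j * (p q (unit_seq j) + 1)"
        using k[of j] pe[of j] c[of j] by (intro mult_mono) auto
      also have "\<dots> = \<epsilon> / (2 * (real N + 1))"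
        using pe[of j] by (simp add: c_def add_nonneg_eq_0_iff)
      finally show "p q (fps_const (e (k j) - fps_nth z j) * unit_seq j) \<le> \<epsilon> / (2 * (real N + 1))" .
    qed
    also have "\<dots> \<le> \<epsilon> / 2" using \<epsilon> by (simp add: field_simps)
    finally have "p q (s - partial_sum N z) \<le> \<epsilon> / 2" .
    moreover have "s \<in> X" by (simp add: s)
    ultimately have "p q (s - z) < \<epsilon>"
      using seminorm_triangle3[OF q _ partial_sum_mem[of N z] z, of s] N by simp
    then show "\<exists>l. p q ((\<Sum>j<length l. fps_const (e (l ! j)) * unit_seq j) - z) < \<epsilon>"
      unfolding s_def by blast
  qed
qed

lemma hypercyclic_vectorI:
  assumes "x \<in> X" "\<And>z q \<epsilon>. z \<in> X \<Longrightarrow> q \<ge> 1 \<Longrightarrow> \<epsilon> > 0 \<Longrightarrow> \<exists>N. p q ((T ^^ N) x - z) < \<epsilon>"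
  shows "x \<in> hypercyclic_vectors (seminorm_topology X p) T"
proof -
  have "z \<in> seminorm_topology X p closure_of range (\<lambda>n. (T ^^ n) x)" if z: "z \<in> X" for z
    unfolding in_closure_of topspace_seminorm_topology
  proof (intro conjI z allI impI)
    fix U assume "z \<in> U \<and> openin (seminorm_topology X p) U"
    then obtain q \<epsilon> where "q \<ge> 1" "\<epsilon> > 0" "{y \<in> X. p q (y - z) < \<epsilon>} \<subseteq> U"
      using open_contains_ball by metis
    moreover then obtain N where "p q ((T ^^ N) x - z) < \<epsilon>" using assms(2) z by blast
    ultimately show "\<exists>y. y \<in> range (\<lambda>n. (T ^^ n) x) \<and> y \<in> U"
      using funpow_shift_mem[OF assms(1)] by blast
  qed
  then show ?thesis
    using assms(1) closure_of_subset_topspace[of "seminorm_topology X p"]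
    by (auto simp: hypercyclic_vectors_def topspace_seminorm_topology)
qed

text \<open>Along suitable \<open>N\<close> the iterates of \<open>x ^ m\<close> approach any
  prescribed target while those of lower powers are small, so a polynomial of degree
  \<open>m\<close> in \<open>x\<close> behaves like its leading term.\<close>

lemma hypercyclic_algebra:
  assumes B: "property_B X p"
  shows "\<exists>x \<in> hypercyclic_vectors (seminorm_topology X p) T.
    generated_algebra x - {0} \<subseteq> hypercyclic_vectors (seminorm_topology X p) T"
proof -
  obtain e :: "nat \<Rightarrow> complex" where e: "\<And>z q \<epsilon>. z \<in> X \<Longrightarrow> q \<ge> 1 \<Longrightarrow> \<epsilon> > 0 \<Longrightarrow>
      \<exists>l :: nat list. p q ((\<Sum>j<length l. fps_const (e (l ! j)) * unit_seq j) - z) < \<epsilon>"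
    by (rule countable_dense_targets) (rule that)
  define target where "target l = (\<Sum>j<length l. fps_const (e (l ! j)) * unit_seq j)" for l
  obtain x where x: "x \<in> X" and approx: "\<And>m r \<delta> l. m \<ge> 1 \<Longrightarrow> r \<ge> 1 \<Longrightarrow> \<delta> > 0 \<Longrightarrow>
      \<exists>N. p r ((T ^^ N) (x ^ m) - target l) < \<delta> \<and> (\<forall>j\<in>{1..<m}. p r ((T ^^ N) (x ^ j)) < \<delta>)"
    unfolding target_def
    by (rule generic_vector[OF B, where L = length and y = "\<lambda>l j. e (l ! j)"])
      (rule that[unfolded target_def])
  have target_mem: "target l \<in> X" for l by (simp add: target_def)
  have hc: "(\<Sum>\<mu>=1..m. fps_const (c \<mu>) * x ^ \<mu>) \<in> hypercyclic_vectors (seminorm_topology X p) T"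
    (is "?P \<in> _") if m: "m \<ge> 1" and cm: "c m \<noteq> 0" for m c
  proof (rule hypercyclic_vectorI)
    show "?P \<in> X" using x by (intro sum_mem scale_mem power_mem) auto
    fix z and q :: nat and \<epsilon> :: real assume z: "z \<in> X" and q: "q \<ge> 1" and \<epsilon>: "\<epsilon> > 0"
    \<comment> \<open>The leading term has the factor \<open>c m\<close>, so \<open>x ^ m\<close>
      has to be steered to \<open>z\<close> divided by \<open>c m\<close>.\<close>
    define z' where "z' = fps_const (inverse (c m)) * z"
    have z': "z' \<in> X" "fps_const (c m) * z' = z"
      using z cm by (simp_all add: z'_def flip: mult.assoc)
    obtain l where l: "p q (target l - z') < \<epsilon> / (2 * norm (c m))"
      using e[OF z'(1) q, of "\<epsilon> / (2 * norm (c m))"] \<epsilon> cm by (auto simp: target_def)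
    \<comment> \<open>Collects all coefficients that multiply an error \<open>\<delta>\<close>; then
      \<open>S * \<delta>\<close> is \<open>\<epsilon> / 2\<close>, and the other half is left for
      the approximation of \<open>z'\<close> by the target.\<close>
    define S where "S = norm (c m) + (\<Sum>\<mu>=1..<m. norm (c \<mu>))"
    have S: "S > 0" using cm by (simp add: S_def add_pos_nonneg sum_nonneg)
    define \<delta> where "\<delta> = \<epsilon> / (2 * S)"
    have \<delta>: "\<delta> > 0" using \<epsilon> S by (simp add: \<delta>_def)
    obtain N where N: "p q ((T ^^ N) (x ^ m) - target l) < \<delta>"
      "\<And>j. j \<in> {1..<m} \<Longrightarrow> p q ((T ^^ N) (x ^ j)) < \<delta>"
      using approx[OF m q \<delta>, of l] by blast
    define Y where "Y = (T ^^ N) (x ^ m)"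
    define Z where "Z = (\<Sum>\<mu>=1..<m. fps_const (c \<mu>) * (T ^^ N) (x ^ \<mu>))"
    have Y: "Y \<in> X" using x m by (simp add: Y_def power_mem)
    have Z: "Z \<in> X"
      unfolding Z_def using x by (intro sum_mem scale_mem funpow_shift_mem power_mem) auto
    have "{1..m} = insert m {1..<m}" using m by auto
    then have "?P = fps_const (c m) * x ^ m + (\<Sum>\<mu>=1..<m. fps_const (c \<mu>) * x ^ \<mu>)"
      by simp
    then have "(T ^^ N) ?P = fps_const (c m) * Y + Z"
      by (simp add: Y_def Z_def funpow_shift_add funpow_shift_sum funpow_shift_scale)
    then have eq: "(T ^^ N) ?P - z
        = (fps_const (c m) * (Y - target l) + fps_const (c m) * (target l - z')) + Z"
      using z'(2) by (simp add: algebra_simps)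
    have "p q Z \<le> (\<Sum>\<mu>=1..<m. p q (fps_const (c \<mu>) * (T ^^ N) (x ^ \<mu>)))"
      unfolding Z_def using x
      by (intro seminorm_sum[OF q] scale_mem funpow_shift_mem power_mem) auto
    also have "\<dots> \<le> (\<Sum>\<mu>=1..<m. norm (c \<mu>) * \<delta>)"
    proof (rule sum_mono)
      fix \<mu> assume \<mu>: "\<mu> \<in> {1..<m}"
      then have "(T ^^ N) (x ^ \<mu>) \<in> X" using x by (intro funpow_shift_mem power_mem) auto
      then show "p q (fps_const (c \<mu>) * (T ^^ N) (x ^ \<mu>)) \<le> norm (c \<mu>) * \<delta>"
        using N(2)[OF \<mu>] by (simp add: seminorm_scale[OF q] mult_left_mono)
    qed
    finally have pZ: "p q Z \<le> (\<Sum>\<mu>=1..<m. norm (c \<mu>)) * \<delta>" by (simp add: sum_distrib_right)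
    have "p q ((T ^^ N) ?P - z)
        \<le> p q (fps_const (c m) * (Y - target l)) + p q (fps_const (c m) * (target l - z')) + p q Z"
      unfolding eq
      using Y Z z' target_mem
      by (intro order_trans[OF seminorm_triangle[OF q]] add_right_mono seminorm_triangle[OF q]) auto
    also have "\<dots> = norm (c m) * p q (Y - target l) + norm (c m) * p q (target l - z') + p q Z"
      using Y z' target_mem by (simp add: seminorm_scale[OF q])
    also have "\<dots> < norm (c m) * \<delta> + norm (c m) * (\<epsilon> / (2 * norm (c m)))
        + (\<Sum>\<mu>=1..<m. norm (c \<mu>)) * \<delta>"
      using N(1) l pZ cm unfolding Y_def
      by (intro add_less_le_mono add_strict_mono mult_strict_left_mono) auto
    also have "\<dots> = S * \<delta> + \<epsilon> / 2" using cm by (simp add: S_def algebra_simps)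
    also have "\<dots> = \<epsilon>" using S by (simp add: \<delta>_def)
    finally show "\<exists>N. p q ((T ^^ N) ?P - z) < \<epsilon>" by blast
  qed
  show ?thesis
  proof (intro bexI subsetI)
    show "x \<in> hypercyclic_vectors (seminorm_topology X p) T"
      using hc[of 1 "\<lambda>_. 1"] by simp
    fix P assume "P \<in> generated_algebra x - {0}"
    then obtain K c where P: "P = (\<Sum>\<mu>=1..K. fps_const (c \<mu>) * x ^ \<mu>)" "P \<noteq> 0"
      unfolding generated_algebra_eq by blast
    \<comment> \<open>The given representation may end in zero coefficients; cutting it at the
      largest element of \<open>J\<close> provides the nonzero leading coefficient that
      \<open>hc\<close> demands.\<close>
    define J where "J = {\<mu> \<in> {1..K}. c \<mu> \<noteq> 0}"
    have "J \<noteq> {}"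
    proof
      assume "J = {}"
      then have "P = 0" unfolding P(1) J_def by (intro sum.neutral) auto
      then show False using P(2) by simp
    qed
    moreover have "finite J" by (simp add: J_def)
    ultimately obtain m where m: "m \<in> J" "\<And>\<mu>. \<mu> \<in> J \<Longrightarrow> \<mu> \<le> m"
      using Max_in Max_ge by metis
    have "P = (\<Sum>\<mu>=1..m. fps_const (c \<mu>) * x ^ \<mu>)"
      unfolding P(1)
    proof (rule sum.mono_neutral_right)
      show "\<forall>\<mu>\<in>{1..K} - {1..m}. fps_const (c \<mu>) * x ^ \<mu> = 0"
      proof
        fix \<mu> assume \<mu>: "\<mu> \<in> {1..K} - {1..m}"
        then have "\<mu> \<notin> J" using m(2)[of \<mu>] by auto
        then have "c \<mu> = 0" using \<mu> by (simp add: J_def)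
        then show "fps_const (c \<mu>) * x ^ \<mu> = 0" by simp
      qed
    qed (use m(1) in \<open>auto simp: J_def\<close>)
    then show "P \<in> hypercyclic_vectors (seminorm_topology X p) T"
      using hc[of m c] m(1) by (simp add: J_def)
  qed
qed

end

theorem theorem3p5:
  fixes X :: "complex fps set" and p :: "nat \<Rightarrow> complex fps \<Rightarrow> real" and w :: "nat \<Rightarrow> complex"
  assumes "frechet_sequence_algebra X p"
    and "schauder_basis X p unit_seq"
    and "property_B X p"
    and "is_weight w"
    and "weighted_backward_shift w ` X \<subseteq> X"
    and "mixing (seminorm_topology X p) (weighted_backward_shift w)"
  shows "\<exists>x \<in> hypercyclic_vectors (seminorm_topology X p) (weighted_backward_shift w).
    generated_algebra x - {0}
      \<subseteq> hypercyclic_vectors (seminorm_topology X p) (weighted_backward_shift w)"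
proof -
  interpret frechet_sequence_algebra X p by fact
  interpret frechet_sequence_algebra_shift X p w by unfold_locales fact+
  show ?thesis using assms(3) by (rule hypercyclic_algebra)
qed

end
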